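(* For every map $M$, the Krushkal polynomial $\mathcal K(M;X,Y,A^{1/2},B^{1/2})$ is a specialization of the surface Tutte polynomial $\mathcal T(M;\mathbf x,\mathbf y)$: $$\mathcal K(M;X,Y,A^{1/2},B^{1/2})=(X-1)^{-k(M)}\,\mathcal T(M;\mathbf x,\mathbf y),$$ in which $\mathbf x$ and $\mathbf y$ are set equal to the following values: $x=1$, $y=Y$; $x_g=A^{g}$ and $y_g=(X-1)B^{g}$ for $g\ge0$; $x_{-g}=A^{g/2}$ and $y_{-g}=(X-1)B^{g/2}$ for $g\ge1$.
   Context: MAPS. Permutations are composed right to left. A connected map $(\theta,\sigma,\tau;C)$ consists of a finite set $C$ of $4m$ elements ("crosses"), $m\ge 1$, and permutations $\theta,\sigma,\tau$ of $C$ such that (1) $\theta^2=\sigma^2=\mathrm{id}$ and $\theta\sigma=\sigma\theta$; (2) for every $a\in C$ the elements $a,\theta a,\sigma a,\theta\sigma a$ are distinct; (3) $\tau\sigma=\sigma\tau^{-1}$; (4) for every $a\in C$ the orbits of $a$ and $\sigma a$ under $\langle\tau\rangle$ are distinct; (5) $\langle\theta,\sigma,\tau\rangle$ acts transitively on $C$. In addition, for $m=0$, there is the connected map consisting of an isolated vertex: $C=\emptyset$, and by convention $\tau$ (and likewise $\tau\theta\sigma$) consists of one pair of empty cycles; it has one vertex, no edges and one face. A map is a finite disjoint union of connected maps, called its connected components. Put $\varphi=\tau\theta\sigma$. The edges are the orbits $\{a,\theta a,\sigma a,\theta\sigma a\}$ of $\langle\theta,\sigma\rangle$; the vertices are the pairs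 consisting of the cycle of $\tau$ through $a$ and the cycle of $\tau$ through $\sigma a$ (and the pairs of empty cycles); the faces are the pairs consisting of the cycle of $\varphi$ through $a$ and the cycle of $\varphi$ through $\theta a$ (and one face for each isolated vertex component). The sets of vertices, edges, faces are $V,E,F$, of sizes $v(M),e(M),f(M)$; $k(M)$ is the number of connected components. GENUS. A connected map is orientable if it is an isolated vertex or if $\langle\theta\sigma,\tau\rangle$ has exactly two orbits on $C$, and non-orientable if $\langle\theta\sigma,\tau\rangle$ is transitive on $C$ (exactly one of these occurs). The Euler genus of a map is $s(M)=2k(M)-v(M)+e(M)-f(M)$. For a connected map the genus is $g(M)=s(M)/2$ if orientable and $g(M)=s(M)$ if non-orientable; the signed genus is $\bar g(M)=g(M)$ if orientable and $\bar g(M)=-g(M)$ if non-orientable. DELETION AND CONTRACTION. For an edge $e=\{a,\theta a,\sigma a,\theta\sigma a\}$ of $M=(\theta,\sigma,\tau;C)$: $M\backslash e=(\theta',\sigma',\tau';C\setminus e)$, where $\theta',\sigma'$ are restrictions of $\theta,\sigma$, $\tau' b=\tau^j b$ with $j\ge1$ minimal such that $\tau^j b\notin e$, empty cycles of $\tau$ are kept, and $\tau'$ gets one extra empty cycle for each cycle of $\tau$ all of whose crosses lie in $e$. $M/e=(\theta'',\sigma'',\tau'';C\setminus e)$, where $\theta'',\sigma''$ are restrictions of $\theta,\sigma$, and $\tau'' b=\tau b$ if $\tau b\notin e$; $\tau'' b=\tau\theta\sigma\tau b$ if $\tau b\in e$ and $\tau\theta\sigma\tau b\notin e$; $\tau''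 b=\tau(\theta\sigma\tau)^2b$ if $\tau b,\tau\theta\sigma\tau b\in e$; empty cycles of $\tau$ are kept, and $\tau''$ gets one extra empty cycle for each cycle of $\tau\theta\sigma$ all of whose crosses lie in $e$. For a set $B$ of edges, $M\backslash B$ and $M/B$ are obtained by deleting, respectively contracting, all edges of $B$ (the order is immaterial). SURFACE TUTTE POLYNOMIAL. With $n(M)=e(M)-v(M)+k(M)$ and $n^*(M)=e(M)-f(M)+k(M)$, and indeterminates $\mathbf x=(x;\dots,x_{-1},x_0,x_1,\dots)$, $\mathbf y=(y;\dots,y_{-1},y_0,y_1,\dots)$, $$\mathcal T(M;\mathbf x,\mathbf y)=\sum_{S\subseteq E}x^{n^*(M/S)}y^{n(M\backslash S^c)}\prod_{M_i}x_{\bar g(M_i)}\prod_{M_j}y_{\bar g(M_j)},$$ where $S^c=E\setminus S$, $M_i$ ranges over the connected components of $M/S$ and $M_j$ over those of $M\backslash S^c$. KRUSHKAL POLYNOMIAL (in Butler's form, for orientable or non-orientable maps): $$\mathcal K(M;x,y,a^{1/2},b^{1/2})=\sum_{S\subseteq E}(x-1)^{k(M\backslash S^c)-k(M)}y^{n(M\backslash S^c)}a^{s(M/S)/2}b^{s(M\backslash S^c)/2}.$$ *)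

theory Defs
  imports
    "HOL-Algebra.Generated_Groups"
    "HOL-Algebra.Bij"
    "HOL-Combinatorics.Orbits"
    "HOL-Library.Multiset"
    "HOL-Library.Poly_Mapping"
    "HOL-Computational_Algebra.Polynomial_Factorial"
begin

section \<open>Maps\<close>

text \<open>
  A map is given by its set of crosses, the permutations \<open>\<theta>\<close>, \<open>\<sigma>\<close>, \<open>\<tau>\<close> (functions that are the
  identity outside the crosses, as in \<^const>\<open>permutes\<close>) and the number of empty cycles of \<open>\<tau>\<close>.
  Empty cycles come in pairs, one pair for each isolated vertex.
\<close>

record 'a cmap =
  crosses :: "'a set"
  theta :: "'a \<Rightarrow> 'a"
  sigma :: "'a \<Rightarrow> 'a"
  tau :: "'a \<Rightarrow> 'a"
  empty_cycles :: nat

definition phi :: "'a cmap \<Rightarrow> 'a \<Rightarrow> 'a" where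
  "phi M = tau M \<circ> theta M \<circ> sigma M"

text \<open>
  The orbit of \<open>a\<close> under the group of permutations generated by \<open>H\<close>; the product of
  \<^term>\<open>BijGroup UNIV\<close> is composition from right to left.
\<close>

definition group_orbit :: "('a \<Rightarrow> 'a) set \<Rightarrow> 'a \<Rightarrow> 'a set" where
  "group_orbit H a = (\<lambda>h. h a) ` generate (BijGroup UNIV) H"

definition group_orbits :: "('a \<Rightarrow> 'a) set \<Rightarrow> 'a set \<Rightarrow> 'a set set" where
  "group_orbits H A = group_orbit H ` A"

definition transitive_on :: "('a \<Rightarrow> 'a) set \<Rightarrow> 'a set \<Rightarrow> bool" where
  "transitive_on H A \<longleftrightarrow> (\<forall>a\<in>A. group_orbit H a = A)"

definition isolated_vertex :: "'a cmap" where
  "isolated_vertex = \<lparr>crosses = {}, theta = id, sigma = id, tau = id, empty_cycles = 2\<rparr>"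

definition connected_map :: "'a cmap \<Rightarrow> bool" where
  "connected_map M \<longleftrightarrow> M = isolated_vertex \<or>
     (let C = crosses M; \<theta> = theta M; \<sigma> = sigma M; \<tau> = tau M in
       finite C \<and> (\<exists>m\<ge>1. card C = 4 * m) \<and>
       \<theta> permutes C \<and> \<sigma> permutes C \<and> \<tau> permutes C \<and> empty_cycles M = 0 \<and>
       \<theta> \<circ> \<theta> = id \<and> \<sigma> \<circ> \<sigma> = id \<and> \<theta> \<circ> \<sigma> = \<sigma> \<circ> \<theta> \<and>
       (\<forall>a\<in>C. distinct [a, \<theta> a, \<sigma> a, \<theta> (\<sigma> a)]) \<and>
       \<tau> \<circ> \<sigma> = \<sigma> \<circ> inv_into UNIV \<tau> \<and>
       (\<forall>a\<in>C. orbit \<tau> a \<noteq> orbit \<tau> (\<sigma> a)) \<and>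
       transitive_on {\<theta>, \<sigma>, \<tau>} C)"

text \<open>
  For permutations moving only disjoint sets of crosses, composition is the union.
\<close>

definition map_union :: "'a cmap \<Rightarrow> 'a cmap \<Rightarrow> 'a cmap" where
  "map_union M N =
     \<lparr>crosses = crosses M \<union> crosses N,
      theta = theta M \<circ> theta N,
      sigma = sigma M \<circ> sigma N,
      tau = tau M \<circ> tau N,
      empty_cycles = empty_cycles M + empty_cycles N\<rparr>"

definition empty_map :: "'a cmap" where
  "empty_map = \<lparr>crosses = {}, theta = id, sigma = id, tau = id, empty_cycles = 0\<rparr>"

inductive is_map :: "'a cmap \<Rightarrow> bool" where
  is_map_empty: "is_map empty_map"
| is_map_union: "is_map M \<Longrightarrow> connected_map N \<Longrightarrow> crosses M \<inter> crosses N = {} \<Longrightarrow> is_map (map_union M N)"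

definition restrict_map_to :: "'a cmap \<Rightarrow> 'a set \<Rightarrow> 'a cmap" where
  "restrict_map_to M A =
     \<lparr>crosses = A,
      theta = perm_restrict (theta M) A,
      sigma = perm_restrict (sigma M) A,
      tau = perm_restrict (tau M) A,
      empty_cycles = 0\<rparr>"

text \<open>A multiset, because isolated vertices are indistinguishable.\<close>

definition components :: "'a cmap \<Rightarrow> 'a cmap multiset" where
  "components M =
     image_mset (restrict_map_to M)
       (mset_set (group_orbits {theta M, sigma M, tau M} (crosses M)))
     + replicate_mset (empty_cycles M div 2) isolated_vertex"

definition map_edge :: "'a cmap \<Rightarrow> 'a \<Rightarrow> 'a set" where
  "map_edge M a = {a, theta M a, sigma M a, theta M (sigma M a)}"

definition edges :: "'a cmap \<Rightarrow> 'a set set" where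
  "edges M = map_edge M ` crosses M"

text \<open>
  Vertices and faces are counted as unordered pairs of cycles (each cycle being given by its set
  of crosses), together with one vertex and one face for each isolated vertex.
\<close>

definition num_vertices :: "'a cmap \<Rightarrow> nat" where
  "num_vertices M =
     card {{orbit (tau M) a, orbit (tau M) (sigma M a)} | a. a \<in> crosses M} + empty_cycles M div 2"

definition num_edges :: "'a cmap \<Rightarrow> nat" where
  "num_edges M = card (edges M)"

definition num_faces :: "'a cmap \<Rightarrow> nat" where
  "num_faces M =
     card {{orbit (phi M) a, orbit (phi M) (theta M a)} | a. a \<in> crosses M} + empty_cycles M div 2"

definition num_components :: "'a cmap \<Rightarrow> nat" where
  "num_components M = size (components M)"


section \<open>Genus\<close>

text \<open>
  For connected maps; such a map is non-orientable iff the group generated by \<open>\<theta>\<sigma>\<close> and \<open>\<tau>\<close> is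
  transitive on its nonempty set of crosses, and exactly one of the two cases occurs.
\<close>

definition orientable :: "'a cmap \<Rightarrow> bool" where
  "orientable M \<longleftrightarrow> M = isolated_vertex \<or>
     card (group_orbits {theta M \<circ> sigma M, tau M} (crosses M)) = 2"

definition euler_genus :: "'a cmap \<Rightarrow> int" where
  "euler_genus M =
     2 * int (num_components M) - int (num_vertices M) + int (num_edges M) - int (num_faces M)"

text \<open>The Euler genus of an orientable connected map is even, so the integer division is exact.\<close>

definition genus :: "'a cmap \<Rightarrow> int" where
  "genus M = (if orientable M then euler_genus M div 2 else euler_genus M)"

definition signed_genus :: "'a cmap \<Rightarrow> int" where
  "signed_genus M = (if orientable M then genus M else - genus M)"


section \<open>Deletion and contraction\<close>

definition delete_edge :: "'a cmap \<Rightarrow> 'a set \<Rightarrow> 'a cmap" where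
  "delete_edge M e =
     (let C = crosses M - e; \<tau> = tau M in
      \<lparr>crosses = C,
       theta = perm_restrict (theta M) C,
       sigma = perm_restrict (sigma M) C,
       tau = perm_restrict (\<lambda>b. (\<tau> ^^ (LEAST j. j \<ge> 1 \<and> (\<tau> ^^ j) b \<notin> e)) b) C,
       empty_cycles = empty_cycles M + card {orbit \<tau> a | a. a \<in> crosses M \<and> orbit \<tau> a \<subseteq> e}\<rparr>)"

definition contract_edge :: "'a cmap \<Rightarrow> 'a set \<Rightarrow> 'a cmap" where
  "contract_edge M e =
     (let C = crosses M - e; \<theta> = theta M; \<sigma> = sigma M; \<tau> = tau M; \<rho> = \<theta> \<circ> \<sigma> \<circ> \<tau> in
      \<lparr>crosses = C,
       theta = perm_restrict \<theta> C,
       sigma = perm_restrict \<sigma> C,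
       tau = perm_restrict
         (\<lambda>b. if \<tau> b \<notin> e then \<tau> b
              else if \<tau> (\<rho> b) \<notin> e then \<tau> (\<rho> b)
              else \<tau> (\<rho> (\<rho> b))) C,
       empty_cycles = empty_cycles M + card {orbit (phi M) a | a. a \<in> crosses M \<and> orbit (phi M) a \<subseteq> e}\<rparr>)"

text \<open>The order in which the edges of a set are deleted or contracted is immaterial; some order is chosen.\<close>

definition delete_edges :: "'a cmap \<Rightarrow> 'a set set \<Rightarrow> 'a cmap" where
  "delete_edges M B = foldl delete_edge M (SOME es. distinct es \<and> set es = B)"

definition contract_edges :: "'a cmap \<Rightarrow> 'a set set \<Rightarrow> 'a cmap" where
  "contract_edges M B = foldl contract_edge M (SOME es. distinct es \<and> set es = B)"

definition nullity :: "'a cmap \<Rightarrow> int" where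
  "nullity M = int (num_edges M) - int (num_vertices M) + int (num_components M)"

definition dual_nullity :: "'a cmap \<Rightarrow> int" where
  "dual_nullity M = int (num_edges M) - int (num_faces M) + int (num_components M)"


section \<open>Polynomials\<close>

text \<open>Polynomials over the integers in commuting indeterminates indexed by \<open>'v\<close>.\<close>

type_synonym 'v mpoly = "('v \<Rightarrow>\<^sub>0 nat) \<Rightarrow>\<^sub>0 int"

definition var :: "'v \<Rightarrow> 'v mpoly" where
  "var v = Poly_Mapping.single (Poly_Mapping.single v 1) 1"

definition substitute :: "('v \<Rightarrow> 'r::comm_ring_1) \<Rightarrow> 'v mpoly \<Rightarrow> 'r" where
  "substitute z p =
     (\<Sum>m\<in>Poly_Mapping.keys p. of_int (Poly_Mapping.lookup p m) *
        (\<Prod>v\<in>Poly_Mapping.keys m. z v ^ Poly_Mapping.lookup m v))"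

text \<open>The indeterminates \<open>x\<close>, \<open>x\<^sub>i\<close>, \<open>y\<close>, \<open>y\<^sub>i\<close> (for integers \<open>i\<close>) of the surface Tutte polynomial.\<close>

datatype tutte_var = Tx | Txi int | Ty | Tyi int

text \<open>
  The indeterminates \<open>x\<close>, \<open>y\<close>, \<open>a\<^sup>1\<^sup>/\<^sup>2\<close>, \<open>b\<^sup>1\<^sup>/\<^sup>2\<close> of the Krushkal polynomial. They are ordered
  (arbitrarily) only because the library's proof that polynomials form an integral domain, which
  is needed for the field of rational functions, asks for a linear order.
\<close>

datatype krushkal_var = Kx | Ky | Ksqrt_a | Ksqrt_b

instantiation krushkal_var :: linorder
begin

definition krushkal_var_rank :: "krushkal_var \<Rightarrow> nat" where
  "krushkal_var_rank v = (case v of Kx \<Rightarrow> 0 | Ky \<Rightarrow> 1 | Ksqrt_a \<Rightarrow> 2 | Ksqrt_b \<Rightarrow> 3)"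

definition less_eq_krushkal_var :: "krushkal_var \<Rightarrow> krushkal_var \<Rightarrow> bool" where
  "less_eq_krushkal_var u v \<longleftrightarrow> krushkal_var_rank u \<le> krushkal_var_rank v"

definition less_krushkal_var :: "krushkal_var \<Rightarrow> krushkal_var \<Rightarrow> bool" where
  "less_krushkal_var u v \<longleftrightarrow> krushkal_var_rank u < krushkal_var_rank v"

instance
  by standard
    (auto simp: less_eq_krushkal_var_def less_krushkal_var_def krushkal_var_rank_def
          split: krushkal_var.splits)

end

text \<open>
  All exponents below are nonnegative for maps, so \<^const>\<open>nat\<close> and the subtraction of natural
  numbers do not truncate.
\<close>

definition surface_tutte :: "'a cmap \<Rightarrow> tutte_var mpoly" where
  "surface_tutte M =
     (\<Sum>S\<in>Pow (edges M).
        var Tx ^ nat (dual_nullity (contract_edges M S)) *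
        var Ty ^ nat (nullity (delete_edges M (edges M - S))) *
        (\<Prod>N\<in>#components (contract_edges M S). var (Txi (signed_genus N))) *
        (\<Prod>N\<in>#components (delete_edges M (edges M - S)). var (Tyi (signed_genus N))))"

text \<open>The power \<open>a\<^sup>s\<^sup>/\<^sup>2\<close> is the \<open>s\<close>-th power of the indeterminate \<open>a\<^sup>1\<^sup>/\<^sup>2\<close>.\<close>

definition krushkal :: "'a cmap \<Rightarrow> krushkal_var mpoly" where
  "krushkal M =
     (\<Sum>S\<in>Pow (edges M).
        (var Kx - 1) ^ (num_components (delete_edges M (edges M - S)) - num_components M) *
        var Ky ^ nat (nullity (delete_edges M (edges M - S))) *
        var Ksqrt_a ^ nat (euler_genus (contract_edges M S)) *
        var Ksqrt_b ^ nat (euler_genus (delete_edges M (edges M - S))))"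

end

theory Submission
  imports Defs
begin

text \<open>
  The identity holds summand by summand. The values of \<open>x\<^sub>g\<close> and \<open>y\<^sub>g\<close> at the signed genus of a
  component depend only on its Euler genus, provided the latter is nonnegative, and even when the
  component is orientable; since the Euler genus is additive over components, the products become
  powers with exponents \<open>s(M/S)\<close>, \<open>s(M \<setminus> S\<^sup>c)\<close> and \<open>k(M \<setminus> S\<^sup>c)\<close>.

  Both properties of the Euler genus come from counting cycles: multiplying a permutation by a
  transposition changes the number of cycles by one, which gives the genus inequality for two
  permutations. It is applied to \<open>\<tau>\<close> and \<open>\<theta>\<sigma>\<close>, whose product is \<open>\<phi>\<close>, on all crosses for nonnegativity
  and on one of the two orbits of \<open>\<langle>\<theta>\<sigma>, \<tau>\<rangle>\<close> for the parity. Maps are handled through the involutions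
  \<open>\<theta>\<close>, \<open>\<sigma>\<close>, \<open>\<tau>\<sigma>\<close>; exchanging \<open>\<theta>\<close> and \<open>\<sigma>\<close> is duality, which reduces contraction to deletion.
\<close>

section \<open>Orbits of permutation groups\<close>

text \<open>Isolated vertices aside, a map has \<open>4 e\<close> crosses, on which
  \<open>\<tau>\<close>, \<open>\<theta>\<sigma>\<close> and \<open>\<phi>\<close> have
  \<open>2 v\<close>, \<open>2 e\<close> and \<open>2 f\<close> cycles, since
  \<open>\<sigma>\<close> pairs the cycles of \<open>\<tau>\<close> and \<open>\<theta>\<close>
  those of \<open>\<phi>\<close>. If \<open>\<langle>\<theta>\<sigma>, \<tau>\<rangle>\<close> has
  \<open>o\<close> orbits, the genus inequality reads
  \<open>2 v + 2 e + 2 f \<le> 4 e + 2 o\<close>, and \<open>o \<le> 2 k\<close> turns it into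
  \<open>s \<ge> 0\<close>. On one of the two orbits of an orientable component these counts are
  halved, and parity makes \<open>3 e + v + f\<close> even. Deletion and contraction are given by
  formulas for \<open>\<tau>\<close>, not by a decomposition into connected maps, so the inductive
  \<open>is_map\<close> is hard to carry through them; a locale of pointwise axioms is preserved
  instead. The exponent of \<open>X - 1\<close> is a subtraction of natural numbers. It agrees with
  division by \<open>(X - 1)^k(M)\<close> because deletion never lowers the number of components: a
  component losing all its crosses survives through empty cycles.\<close>

lemma carrier_BijGroup_UNIV: "carrier (BijGroup UNIV) = {f. bij f}"
  by (simp add: BijGroup_def Bij_def)

lemma mult_BijGroup_UNIV:
  assumes "bij g" "bij h"
  shows "g \<otimes>\<^bsub>BijGroup UNIV\<^esub> h = g \<circ> h"
  using assms by (auto simp: BijGroup_def Bij_def compose_def)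

lemma one_BijGroup_UNIV: "\<one>\<^bsub>BijGroup UNIV\<^esub> = id"
  by (auto simp: BijGroup_def)

lemma generate_BijGroup_bij:
  assumes "\<forall>h\<in>H. bij h" "g \<in> generate (BijGroup UNIV) H"
  shows "bij g"
  using group.generate_in_carrier[OF group_BijGroup, of H UNIV g] assms
  by (auto simp: carrier_BijGroup_UNIV)

lemma generate_BijGroup_inverse:
  assumes H: "\<forall>h\<in>H. bij h" and g: "g \<in> generate (BijGroup UNIV) H"
  obtains g' where "g' \<in> generate (BijGroup UNIV) H" "\<And>x. g' (g x) = x" "\<And>x. g (g' x) = x"
proof -
  let ?g' = "inv\<^bsub>BijGroup UNIV\<^esub> g"
  have H': "H \<subseteq> carrier (BijGroup UNIV)"
    using H by (auto simp: carrier_BijGroup_UNIV)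
  have g': "?g' \<in> generate (BijGroup UNIV) H"
    using group.generate_m_inv_closed[OF group_BijGroup H' g] .
  have c: "g \<in> carrier (BijGroup UNIV)"
    using generate_BijGroup_bij[OF H g] by (simp add: carrier_BijGroup_UNIV)
  have "?g' \<circ> g = id" "g \<circ> ?g' = id"
    using group.l_inv[OF group_BijGroup c] group.r_inv[OF group_BijGroup c]
      mult_BijGroup_UNIV[OF generate_BijGroup_bij[OF H g'] generate_BijGroup_bij[OF H g]]
      mult_BijGroup_UNIV[OF generate_BijGroup_bij[OF H g] generate_BijGroup_bij[OF H g']]
    by (auto simp: one_BijGroup_UNIV)
  with g' show ?thesis by (intro that) (auto simp: fun_eq_iff)
qed

lemma group_orbit_self: "a \<in> group_orbit H a"
proof -
  have "\<one>\<^bsub>BijGroup UNIV\<^esub> a \<in> group_orbit H a"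
    unfolding group_orbit_def by (intro imageI generate.one)
  then show ?thesis by (simp add: one_BijGroup_UNIV)
qed

lemma group_orbit_trans:
  assumes H: "\<forall>h\<in>H. bij h" and "b \<in> group_orbit H a" "c \<in> group_orbit H b"
  shows "c \<in> group_orbit H a"
proof -
  obtain g g' where g: "g \<in> generate (BijGroup UNIV) H" "b = g a"
    "g' \<in> generate (BijGroup UNIV) H" "c = g' b"
    using assms(2,3) by (auto simp: group_orbit_def)
  have "g' \<circ> g \<in> generate (BijGroup UNIV) H"
    using generate.eng[OF g(3,1)] generate_BijGroup_bij[OF H] g by (simp add: mult_BijGroup_UNIV)
  then show ?thesis using g unfolding group_orbit_def by (metis comp_apply imageI)
qed

lemma group_orbit_sym:
  assumes H: "\<forall>h\<in>H. bij h" and "b \<in> group_orbit H a"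
  shows "a \<in> group_orbit H b"
proof -
  obtain g where g: "g \<in> generate (BijGroup UNIV) H" "b = g a"
    using assms(2) by (auto simp: group_orbit_def)
  obtain g' where "g' \<in> generate (BijGroup UNIV) H" "g' (g a) = a"
    using generate_BijGroup_inverse[OF H g(1)] by metis
  then show ?thesis using g unfolding group_orbit_def by (metis imageI)
qed

lemma group_orbit_eq:
  assumes "\<forall>h\<in>H. bij h" and "b \<in> group_orbit H a"
  shows "group_orbit H b = group_orbit H a"
  using group_orbit_trans[OF assms(1)] group_orbit_sym[OF assms(1)] assms(2) by blast

lemma group_orbit_step:
  assumes H: "\<forall>h\<in>H. bij h" and "h \<in> H" "b \<in> group_orbit H a"
  shows "h b \<in> group_orbit H a"
proof (rule group_orbit_trans[OF H assms(3)])
  show "h b \<in> group_orbit H b"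
    using generate.incl[OF assms(2)] unfolding group_orbit_def by (rule imageI)
qed

lemma permutes_mem_closed_iff:
  assumes "h permutes S" "finite A" and "\<And>x. x \<in> A \<Longrightarrow> h x \<in> A"
  shows "h x \<in> A \<longleftrightarrow> x \<in> A"
proof -
  have "inj_on h A" using permutes_inj_on[OF assms(1)] .
  then have "h ` A = A" using assms(2,3) by (intro card_subset_eq) (auto simp: card_image)
  then show ?thesis using permutes_inj[OF assms(1)] by (metis image_iff inj_eq)
qed

lemma permutes_imp_bij_all: "\<forall>h\<in>H. h permutes S \<Longrightarrow> \<forall>h\<in>H. bij h"
  using permutes_bij by blast

text \<open>The generated group also contains the inverses of the generators. On a finite
  \<open>A\<close> closure under an injection gives closure under its inverse, so only the
  generators have to be checked.\<close>

lemma group_orbit_subset: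
  assumes H: "\<forall>h\<in>H. h permutes S" and "finite A" "a \<in> A"
    and closed: "\<And>h x. h \<in> H \<Longrightarrow> x \<in> A \<Longrightarrow> h x \<in> A"
  shows "group_orbit H a \<subseteq> A"
proof -
  have bij: "\<forall>h\<in>H. bij h" using H permutes_bij by blast
  have iff: "h x \<in> A \<longleftrightarrow> x \<in> A" if "h \<in> H" for h x
    using permutes_mem_closed_iff[OF bspec[OF H that] assms(2)] closed that by blast
  have "\<forall>x. g x \<in> A \<longleftrightarrow> x \<in> A" if "g \<in> generate (BijGroup UNIV) H" for g
    using that
  proof induction
    case one
    then show ?case by (simp add: one_BijGroup_UNIV)
  next
    case (incl h)
    then show ?case using iff by blast
  next
    case (inv h)
    have h: "h \<in> carrier (BijGroup UNIV)" using bij inv by (auto simp add: carrier_BijGroup_UNIV)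
    have "bij (inv\<^bsub>BijGroup UNIV\<^esub> h)"
      using group.inv_closed[OF group_BijGroup h] by (simp add: carrier_BijGroup_UNIV)
    then have "h \<circ> inv\<^bsub>BijGroup UNIV\<^esub> h = id"
      using group.r_inv[OF group_BijGroup h] bij inv
      by (auto simp add: mult_BijGroup_UNIV one_BijGroup_UNIV)
    then show ?case using iff[OF inv.hyps] by (metis comp_apply id_apply)
  next
    case (eng h1 h2)
    then show ?case
      using generate_BijGroup_bij[OF bij] by (simp add: mult_BijGroup_UNIV)
  qed
  then show ?thesis using assms(3) by (auto simp: group_orbit_def)
qed

lemma group_orbit_subset_carrier:
  assumes "\<forall>h\<in>H. h permutes S" and "finite S" "a \<in> S"
  shows "group_orbit H a \<subseteq> S"
  using assms by (intro group_orbit_subset) (auto simp: permutes_in_image)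

section \<open>Counting cycles\<close>

definition num_cycles :: "('a \<Rightarrow> 'a) \<Rightarrow> 'a set \<Rightarrow> nat" where
  "num_cycles p C = card (orbit p ` C)"

lemma permutes_self_in_orbit:
  assumes "p permutes C" "finite C"
  shows "a \<in> orbit p a"
  using assms by (meson permutation_permutes permutation_self_in_orbit)

lemma permutes_orbit_eq:
  assumes "p permutes C" "finite C" "b \<in> orbit p a"
  shows "orbit p b = orbit p a"
  using orbit_cyclic_eq3[OF cyclic_on_orbit[OF assms(1,2)] assms(3)] .

lemma orbit_closed_subset:
  assumes "a \<in> A" "\<And>x. x \<in> A \<Longrightarrow> p x \<in> A"
  shows "orbit p a \<subseteq> A"
proof
  fix x assume "x \<in> orbit p a"
  then show "x \<in> A" by induction (auto intro: assms)
qed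

text \<open>The new permutation sends \<open>a\<close> to \<open>p b\<close> and \<open>b\<close> to
  \<open>p a\<close>. From \<open>a\<close> it runs through the cycle of \<open>b\<close> and, on
  reaching \<open>b\<close>, crosses over into the cycle of \<open>a\<close>, so the two cycles are
  spliced into one.\<close>

lemma orbit_comp_transpose_merge:
  assumes p: "p permutes C" "finite C" and ab: "b \<notin> orbit p a"
  shows "orbit (p \<circ> Transposition.transpose a b) a = orbit p a \<union> orbit p b"
proof
  let ?q = "p \<circ> Transposition.transpose a b"
  have self: "x \<in> orbit p x" for x using permutes_self_in_orbit[OF p] .
  have ba: "a \<notin> orbit p b" using ab self permutes_orbit_eq[OF p] by blast
  have q: "?q a = p b" "?q b = p a" "\<And>x. x \<noteq> a \<Longrightarrow> x \<noteq> b \<Longrightarrow> ?q x = p x"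
    by (simp_all add: transpose_apply_other)
  show "orbit ?q a \<subseteq> orbit p a \<union> orbit p b"
  proof (rule orbit_closed_subset)
    fix x assume x: "x \<in> orbit p a \<union> orbit p b"
    consider "x = a" | "x = b" | "x \<noteq> a" "x \<noteq> b" by blast
    then show "?q x \<in> orbit p a \<union> orbit p b"
    proof cases
      case 3
      then show ?thesis using x q(3) by (auto intro: orbit.step simp del: o_apply)
    qed (simp_all add: orbit.base)
  qed (use self in blast)
  have B: "orbit p b \<subseteq> orbit ?q a"
  proof
    fix x assume "x \<in> orbit p b"
    then show "x \<in> orbit ?q a"
    proof induction
      case base
      then show ?case using orbit.base[of ?q a] unfolding q(1) .
    next
      case (step y)
      then have "y \<noteq> a" using ba by blast
      then show ?case
        using q(1) q(3)[of y] orbit.base[of ?q a] orbit.step[OF step.IH] by (cases "y = b") (simp_all del: o_apply)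
    qed
  qed
  moreover have "orbit p a \<subseteq> orbit ?q a"
  proof
    fix x assume "x \<in> orbit p a"
    then show "x \<in> orbit ?q a"
    proof induction
      case base
      \<comment> \<open>The cycle of \<open>a\<close> is entered at \<open>p a\<close>, the image
        under \<open>?q\<close> of \<open>b\<close>, which \<open>B\<close> has shown to be
        reached.\<close>
      then show ?case using orbit.step[of b ?q a] B self unfolding q(2) by blast
    next
      case (step y)
      then have "y \<noteq> b" using ab by blast
      moreover have "?q b \<in> orbit ?q a" using B self by (blast intro: orbit.step)
      ultimately show ?case
        using q(2) q(3)[of y] orbit.step[OF step.IH] by (cases "y = a") (simp_all del: o_apply)
    qed
  qed
  ultimately show "orbit p a \<union> orbit p b \<subseteq> orbit ?q a" by blast
qed

lemma orbit_comp_transpose_other: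
  assumes p: "p permutes C" "finite C" and "x \<notin> orbit p a" "x \<notin> orbit p b"
  shows "orbit (p \<circ> Transposition.transpose a b) x = orbit p x"
proof (rule orbit_cong)
  show "x \<in> orbit p x" using permutes_self_in_orbit[OF p] .
  fix s assume "s \<in> orbit p x"
  then have "s \<noteq> a" "s \<noteq> b"
    using assms(3,4) permutes_orbit_eq[OF p, of s x] permutes_self_in_orbit[OF p] by auto
  then show "(p \<circ> Transposition.transpose a b) s = p s" by (simp add: transpose_apply_other)
qed

text \<open>Let \<open>n > 0\<close> be minimal with \<open>p^n b = a\<close>. The segment
  \<open>p b, ..., p^n b = a\<close> omits \<open>b\<close> and is closed under the new permutation,
  which sends its end \<open>a\<close> back to \<open>p b\<close>.\<close>

lemma orbit_comp_transpose_split: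
  assumes p: "p permutes C" "finite C" and ab: "b \<in> orbit p a" "a \<noteq> b"
  shows "b \<notin> orbit (p \<circ> Transposition.transpose a b) a"
proof
  let ?q = "p \<circ> Transposition.transpose a b"
  assume b: "b \<in> orbit ?q a"
  have "a \<in> orbit p b"
    using ab permutes_self_in_orbit[OF p] permutes_orbit_eq[OF p] by blast
  then obtain m where m: "(p ^^ m) b = a" "m > 0" by (auto simp: orbit_altdef)
  define n where "n = (LEAST m. m > 0 \<and> (p ^^ m) b = a)"
  have n: "n > 0" "(p ^^ n) b = a"
    using LeastI[of "\<lambda>m. m > 0 \<and> (p ^^ m) b = a" m] m by (auto simp: n_def)
  have least: "(p ^^ i) b \<noteq> a" if "0 < i" "i < n" for i
    using not_less_Least[of i "\<lambda>m. m > 0 \<and> (p ^^ m) b = a"] that by (auto simp: n_def)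
  have notb: "(p ^^ i) b \<noteq> b" if "0 < i" "i \<le> n" for i
  proof
    assume i: "(p ^^ i) b = b"
    then have "i \<noteq> n" using n ab by auto
    with that have "i < n" by simp
    then have "(p ^^ (n - i + i)) b = a" using n by simp
    then have "(p ^^ (n - i)) b = a" using i by (simp only: funpow_add o_apply)
    then show False using least[of "n - i"] \<open>i < n\<close> that by auto
  qed
  let ?S = "{(p ^^ i) b |i. 0 < i \<and> i \<le> n}"
  have "?q a \<in> ?S" using n by (auto intro!: exI[of _ 1])
  moreover have "?q x \<in> ?S" if "x \<in> ?S" for x
  proof -
    from that obtain i where i: "x = (p ^^ i) b" "0 < i" "i \<le> n" by blast
    show ?thesis
    proof (cases "i = n")
      case True
      then show ?thesis using \<open>?q a \<in> ?S\<close> i n by simp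
    next
      case False
      then have "?q x = p x" using i least[of i] notb[of i] by (simp add: transpose_apply_other)
      then show ?thesis using i False by (auto intro!: exI[of _ "Suc i"])
    qed
  qed
  moreover have "a \<in> ?S" using n by blast
  ultimately have "orbit ?q a \<subseteq> ?S" by (intro orbit_closed_subset)
  then obtain i where "b = (p ^^ i) b" "0 < i" "i \<le> n" using b by blast
  then show False using notb by metis
qed

lemma num_cycles_transpose_merge:
  assumes p: "p permutes C" "finite C" and ab: "a \<in> C" "b \<in> C" "b \<notin> orbit p a"
  shows "num_cycles p C = Suc (num_cycles (p \<circ> Transposition.transpose a b) C)"
proof -
  let ?q = "p \<circ> Transposition.transpose a b"
  let ?R = "orbit p ` C - {orbit p a, orbit p b}"
  note self = permutes_self_in_orbit[OF p] and eq = permutes_orbit_eq[OF p]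
  have q: "?q permutes C" using p ab by (intro permutes_compose permutes_swap_id)
  note qeq = permutes_orbit_eq[OF q p(2)]
  have ne: "orbit p a \<noteq> orbit p b" using ab self by metis
  have m: "orbit ?q x = orbit p a \<union> orbit p b" if "x \<in> orbit p a \<union> orbit p b" for x
    using qeq[of x a] orbit_comp_transpose_merge[OF p ab(3)] that by auto
  have "orbit ?q ` C = insert (orbit p a \<union> orbit p b) ?R"
  proof (intro equalityI subsetI)
    fix X assume "X \<in> orbit ?q ` C"
    then obtain x where x: "x \<in> C" "X = orbit ?q x" by blast
    show "X \<in> insert (orbit p a \<union> orbit p b) ?R"
    proof (cases "x \<in> orbit p a \<union> orbit p b")
      case True
      then show ?thesis using m x by simp
    next
      case False
      then have "X = orbit p x" using x orbit_comp_transpose_other[OF p] by simp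
      then show ?thesis using False x self[of x] by auto
    qed
  next
    fix X assume X: "X \<in> insert (orbit p a \<union> orbit p b) ?R"
    show "X \<in> orbit ?q ` C"
    proof (cases "X = orbit p a \<union> orbit p b")
      case True
      then show ?thesis using m[of a] self[of a] ab by blast
    next
      case False
      with X obtain x where x: "x \<in> C" "X = orbit p x" "X \<noteq> orbit p a" "X \<noteq> orbit p b" by blast
      then have "orbit ?q x = X" using orbit_comp_transpose_other[OF p, of x a b] eq[of x] by auto
      then show ?thesis using x by blast
    qed
  qed
  moreover have "orbit p a \<union> orbit p b \<notin> ?R"
  proof
    assume "orbit p a \<union> orbit p b \<in> ?R"
    then obtain x where x: "orbit p a \<union> orbit p b = orbit p x" "orbit p x \<noteq> orbit p a" by blast
    then show False using eq[of a x] self[of a] by blast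
  qed
  ultimately have "num_cycles ?q C = Suc (card ?R)"
    using p(2) by (simp add: num_cycles_def)
  moreover have "card (orbit p ` C) = card ?R + 2"
    using p(2) ab ne card_Diff_subset[of "{orbit p a, orbit p b}" "orbit p ` C"]
      card_mono[of "orbit p ` C" "{orbit p a, orbit p b}"] by (auto simp: card_insert_if)
  ultimately show ?thesis by (simp add: num_cycles_def)
qed

text \<open>Composing with the same transposition again restores \<open>p\<close>, so a split is a
  merge read backwards.\<close>

lemma num_cycles_transpose_split:
  assumes p: "p permutes C" "finite C" and ab: "a \<in> C" "b \<in> C" "b \<in> orbit p a" "a \<noteq> b"
  shows "num_cycles (p \<circ> Transposition.transpose a b) C = Suc (num_cycles p C)"
proof -
  let ?t = "Transposition.transpose a b"
  have "p \<circ> ?t permutes C" using p ab by (intro permutes_compose permutes_swap_id)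
  from num_cycles_transpose_merge[OF this p(2) ab(1,2) orbit_comp_transpose_split[OF p ab(3,4)]]
  show ?thesis by (simp add: comp_assoc)
qed

section \<open>The genus inequality and parity for two permutations\<close>

lemma num_cycles_id: "finite C \<Longrightarrow> num_cycles id C = card C"
proof -
  have "orbit id a = {a}" for a :: 'a by (simp add: orbit_eq_singleton_iff)
  then show "num_cycles id C = card C"
    unfolding num_cycles_def by (intro card_image) (auto simp: inj_on_def)
qed

text \<open>An orbit avoiding \<open>a\<close> and \<open>c\<close> does not notice the
  transposition and stays an orbit; only the orbits of \<open>a\<close> and \<open>c\<close> can be
  joined. In the induction below, \<open>q\<close> is the permutation with fewer moved points and
  its product with the transposition is the original one.\<close>

lemma card_group_orbits_transpose:
  assumes p: "p permutes C" and q: "q permutes C" and C: "finite C" and ac: "a \<in> C" "c \<in> C"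
    and sub: "\<And>x. x \<in> C \<Longrightarrow> group_orbit {p, q} x \<subseteq> group_orbit {p, q \<circ> Transposition.transpose a c} x"
    and ne: "group_orbit {p, q} a \<noteq> group_orbit {p, q} c"
  shows "card (group_orbits {p, q} C)
    \<le> Suc (card (group_orbits {p, q \<circ> Transposition.transpose a c} C))"
proof -
  let ?t = "Transposition.transpose a c"
  let ?O = "group_orbit {p, q}" and ?O' = "group_orbit {p, q \<circ> ?t}"
  have qt: "q \<circ> ?t permutes C" using q ac by (intro permutes_compose permutes_swap_id)
  have perm: "\<forall>h\<in>{p, q}. h permutes C" "\<forall>h\<in>{p, q \<circ> ?t}. h permutes C"
    using p q qt by simp_all
  have bij: "\<forall>h\<in>{p, q}. bij h" "\<forall>h\<in>{p, q \<circ> ?t}. bij h"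
    using permutes_imp_bij_all[OF perm(1)] permutes_imp_bij_all[OF perm(2)] .
  have "?O ` C - {?O a, ?O c} \<subseteq> ?O' ` C - {?O' a}"
  proof
    fix X assume "X \<in> ?O ` C - {?O a, ?O c}"
    then obtain x where x: "x \<in> C" "X = ?O x" "?O x \<noteq> ?O a" "?O x \<noteq> ?O c" by blast
    then have notin: "a \<notin> X" "c \<notin> X" using group_orbit_eq[OF bij(1)] by blast+
    have "?O' x \<subseteq> X"
    proof (rule group_orbit_subset[OF perm(2)])
      have "X \<subseteq> C" using group_orbit_subset_carrier[of "{p, q}" C x, OF perm(1) C x(1)] x(2) by blast
      then show "finite X" using C finite_subset by blast
      fix h y assume h: "h \<in> {p, q \<circ> ?t}" and y: "y \<in> X"
      have "p y \<in> X" "q y \<in> X" using group_orbit_step[OF bij(1)] y x by auto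
      moreover have "?t y = y" using y notin by (metis transpose_apply_other)
      ultimately show "h y \<in> X" using h by auto
    qed (simp add: x(2) group_orbit_self)
    then have "X = ?O' x" using sub[of x] x by blast
    moreover have "?O' x \<noteq> ?O' a" using notin \<open>X = ?O' x\<close> group_orbit_self by metis
    ultimately show "X \<in> ?O' ` C - {?O' a}" using x by blast
  qed
  then have "card (?O ` C - {?O a, ?O c}) \<le> card (?O' ` C - {?O' a})"
    using C by (intro card_mono) auto
  moreover have "card (?O ` C - {?O a, ?O c}) + 2 = card (?O ` C)"
    using C ac ne card_Diff_subset[of "{?O a, ?O c}" "?O ` C"]
      card_mono[of "?O ` C" "{?O a, ?O c}"] by (auto simp: card_insert_if)
  moreover have "Suc (card (?O' ` C - {?O' a})) = card (?O' ` C)"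
    using C ac by (intro card_Suc_Diff1) auto
  ultimately show ?thesis unfolding group_orbits_def by linarith
qed

text \<open>
  The difference of the two sides is twice the genus of the hypermap given by \<open>p\<close> and \<open>q\<close>, summed over
  its components. The induction splits off a transposition from \<open>q\<close>.
\<close>

lemma num_cycles_genus:
  assumes p: "p permutes C" and q: "q permutes C" and C: "finite C"
  shows "num_cycles p C + num_cycles q C + num_cycles (p \<circ> q) C
      \<le> card C + 2 * card (group_orbits {p, q} C)
    \<and> even (card C + num_cycles p C + num_cycles q C + num_cycles (p \<circ> q) C)"
  using q
proof (induction "card {x. q x \<noteq> x}" arbitrary: q rule: less_induct)
  case less
  note q = less.prems
  show ?case
  proof (cases "q = id")
    case True
    \<comment> \<open>For \<open>q = id\<close> the orbits are the cycles of \<open>p\<close>, and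
      the inequality is an equality.\<close>
    have "group_orbit {p, id} a = orbit p a" if "a \<in> C" for a
    proof
      have H: "\<forall>h\<in>{p, id}. bij h" using p permutes_bij by auto
      show "group_orbit {p, id} a \<subseteq> orbit p a"
        using p C permutes_self_in_orbit[OF p C]
        by (intro group_orbit_subset[of _ C])
          (auto intro: orbit.intros finite_orbit permutes_id simp: permutes_id)
      show "orbit p a \<subseteq> group_orbit {p, id} a"
        by (rule orbit_closed_subset) (auto intro: group_orbit_self group_orbit_step[OF H])
    qed
    then have "group_orbits {p, id} C = orbit p ` C" by (simp add: group_orbits_def)
    then show ?thesis using True C by (auto simp: num_cycles_id) (simp_all add: num_cycles_def)
  next
    case False
    then obtain a where a: "q a \<noteq> a" by (auto simp: fun_eq_iff)
    \<comment> \<open>With \<open>c\<close> the preimage of \<open>a\<close>, the product of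
      \<open>q\<close> with the transposition fixes \<open>a\<close>. No point fixed by
      \<open>q\<close> becomes moved, so the measure drops.\<close>
    obtain c where qc: "q c = a" using permutes_surj[OF q] by (metis surjD)
    have aC: "a \<in> C" using a q by (metis permutes_not_in)
    have cC: "c \<in> C" using qc aC permutes_in_image[OF q] by metis
    have ac: "a \<noteq> c" using a qc by metis
    let ?t = "Transposition.transpose a c"
    define q' where "q' = q \<circ> ?t"
    have q': "q' permutes C"
      using q aC cC unfolding q'_def by (intro permutes_compose permutes_swap_id)
    have qq': "q = q' \<circ> ?t" by (simp add: q'_def comp_assoc)
    have q'a: "q' a = a" by (simp add: q'_def qc)
    have "{x. q' x \<noteq> x} \<subseteq> {x. q x \<noteq> x}"
    proof
      fix x assume "x \<in> {x. q' x \<noteq> x}"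
      then show "x \<in> {x. q x \<noteq> x}" using q'a ac qc
        by (cases "x = a"; cases "x = c") (auto simp: q'_def transpose_apply_other)
    qed
    moreover have "a \<in> {x. q x \<noteq> x} - {x. q' x \<noteq> x}" using a q'a by simp
    moreover have "finite {x. q x \<noteq> x}"
      using C by (rule rev_finite_subset) (use permutes_not_in[OF q] in blast)
    ultimately have "card {x. q' x \<noteq> x} < card {x. q x \<noteq> x}"
      by (intro psubset_card_mono) blast+
    note IH = less.hyps[OF this q']
    have "a \<in> orbit q c" using qc orbit.base by metis
    then have "c \<in> orbit q a"
      using permutes_orbit_eq[OF q C] permutes_self_in_orbit[OF q C] by blast
    then have cq: "num_cycles q' C = Suc (num_cycles q C)"
      unfolding q'_def by (rule num_cycles_transpose_split[OF q C aC cC _ ac])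
    have pq': "p \<circ> q' permutes C" using p q' by (intro permutes_compose)
    have pq: "p \<circ> q = (p \<circ> q') \<circ> ?t" by (simp add: qq' comp_assoc)
    have perm: "\<forall>h\<in>{p, q}. h permutes C" "\<forall>h\<in>{p, q'}. h permutes C"
      using p q q' by simp_all
    have bij: "\<forall>h\<in>{p, q}. bij h" "\<forall>h\<in>{p, q'}. bij h"
      using permutes_imp_bij_all[OF perm(1)] permutes_imp_bij_all[OF perm(2)] .
    let ?O = "group_orbit {p, q}" and ?O' = "group_orbit {p, q'}"
    have sub: "?O' x \<subseteq> ?O x" if x: "x \<in> C" for x
    proof (rule group_orbit_subset[OF perm(2)])
      show "finite (?O x)"
        using group_orbit_subset_carrier[of "{p, q}" C x, OF perm(1) C x] C finite_subset by blast
      fix h y assume h: "h \<in> {p, q'}" and y: "y \<in> ?O x"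
      note st = group_orbit_step[OF bij(1), where a=x]
      have "q' y \<in> ?O x"
      proof (cases "y = a \<or> y = c")
        case True
        then show ?thesis
        proof
          assume "y = a" then show ?thesis using y q'a by simp
        next
          assume "y = c"
          then have "a \<in> ?O x" using st[of q c] y qc by auto
          then have "q a \<in> ?O x" using st[of q a] by auto
          then show ?thesis using \<open>y = c\<close> by (simp add: q'_def)
        qed
      next
        case False
        then have "q' y = q y" by (simp add: q'_def transpose_apply_other)
        then show ?thesis using st[of q y] y by auto
      qed
      moreover have "p y \<in> ?O x" using st[of p y] y by auto
      ultimately show "h y \<in> ?O x" using h by auto
    qed (rule group_orbit_self)
    \<comment> \<open>Going from \<open>q'\<close> to \<open>q\<close> costs one cycle of
      \<open>q\<close>. If \<open>a\<close> and \<open>c\<close> already share an orbit, the orbits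
      stay the same and the cycles of the product change by one in either direction. Otherwise two
      cycles of the product merge as well: the left side falls by two, the right side by at most
      two.\<close>
    show ?thesis
    proof (cases "c \<in> ?O' a")
      case True
      have sub': "?O x \<subseteq> ?O' x" if x: "x \<in> C" for x
      proof (rule group_orbit_subset[OF perm(1)])
        show "finite (?O' x)"
          using group_orbit_subset_carrier[of "{p, q'}" C x, OF perm(2) C x] C finite_subset by blast
        fix h y assume h: "h \<in> {p, q}" and y: "y \<in> ?O' x"
        note st = group_orbit_step[OF bij(2), where a=x]
        have "?t y \<in> ?O' x"
        proof (cases "y = a \<or> y = c")
          case True
          then show ?thesis using y \<open>c \<in> ?O' a\<close> group_orbit_eq[OF bij(2)] group_orbit_self
            by (metis transpose_apply_first transpose_apply_second)
        next
          case False
          then show ?thesis using y by (simp add: transpose_apply_other)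
        qed
        then have "q y \<in> ?O' x" using st[of q' "?t y"] by (simp add: q'_def)
        moreover have "p y \<in> ?O' x" using st[of p y] y by auto
        ultimately show "h y \<in> ?O' x" using h by auto
      qed (rule group_orbit_self)
      have "group_orbits {p, q} C = group_orbits {p, q'} C"
        unfolding group_orbits_def using sub sub' by (intro image_cong) auto
      moreover have "num_cycles (p \<circ> q) C = Suc (num_cycles (p \<circ> q') C)
          \<or> Suc (num_cycles (p \<circ> q) C) = num_cycles (p \<circ> q') C"
        using num_cycles_transpose_split[OF pq' C aC cC _ ac]
          num_cycles_transpose_merge[OF pq' C aC cC] unfolding pq by metis
      ultimately show ?thesis using IH unfolding cq by presburger
    next
      case False
      have "orbit (p \<circ> q') a \<subseteq> ?O' a"
      proof (rule orbit_closed_subset[OF group_orbit_self])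
        fix x assume "x \<in> ?O' a"
        then have "q' x \<in> ?O' a" using group_orbit_step[OF bij(2)] by auto
        then have "p (q' x) \<in> ?O' a" using group_orbit_step[OF bij(2), of p] by auto
        then show "(p \<circ> q') x \<in> ?O' a" by simp
      qed
      then have "c \<notin> orbit (p \<circ> q') a" using False by blast
      from num_cycles_transpose_merge[OF pq' C aC cC this]
      have "num_cycles (p \<circ> q') C = Suc (num_cycles (p \<circ> q) C)" by (simp add: pq)
      moreover have "card (group_orbits {p, q'} C) \<le> Suc (card (group_orbits {p, q} C))"
      proof (rule card_group_orbits_transpose[OF p q' C aC cC, folded qq'])
        show "?O' a \<noteq> ?O' c" using False group_orbit_self by metis
      qed (use sub in blast)      ultimately show ?thesis using IH unfolding cq by presburger
    qed
  qed
qed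

section \<open>Maps not required to be connected\<close>

text \<open>The pairs are disjoint, have two elements each and cover \<open>P\<close>. This serves
  for vertices, faces and the cycles of \<open>\<theta>\<sigma>\<close>.\<close>

lemma card_involution_pairs:
  assumes "finite P" "\<And>X. X \<in> P \<Longrightarrow> i X \<in> P" "\<And>X. X \<in> P \<Longrightarrow> i (i X) = X"
    "\<And>X. X \<in> P \<Longrightarrow> i X \<noteq> X"
  shows "2 * card ((\<lambda>X. {X, i X}) ` P) = card P"
proof -
  have "2 * card ((\<lambda>X. {X, i X}) ` P) = card (\<Union>((\<lambda>X. {X, i X}) ` P))"
  proof (rule card_partition)
    show "card c = 2" if "c \<in> (\<lambda>X. {X, i X}) ` P" for c
      using that assms(4) by (force simp: card_insert_if)
    show "c1 \<inter> c2 = {}"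
      if "c1 \<in> (\<lambda>X. {X, i X}) ` P" "c2 \<in> (\<lambda>X. {X, i X}) ` P" "c1 \<noteq> c2" for c1 c2
      using that assms(3) by (auto simp: doubleton_eq_iff) metis+
  qed (use assms in auto)
  also have "\<Union>((\<lambda>X. {X, i X}) ` P) = P" using assms(2) by auto
  finally show ?thesis .
qed

text \<open>
  The vertex condition \<open>\<tau> a \<noteq> \<sigma> a\<close> is the pointwise form of the requirement that the orbits of
  \<open>a\<close> and \<open>\<sigma> a\<close> under \<open>\<tau>\<close> be distinct: it says that the involution \<open>\<tau>\<sigma>\<close> has no fixed point.
\<close>

locale premap =
  fixes M :: "'a cmap"
  assumes finite_crosses: "finite (crosses M)"
    and theta_permutes: "theta M permutes crosses M"
    and sigma_permutes: "sigma M permutes crosses M"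
    and tau_permutes: "tau M permutes crosses M"
    and theta_theta: "theta M (theta M x) = x"
    and sigma_sigma: "sigma M (sigma M x) = x"
    and theta_sigma: "theta M (sigma M x) = sigma M (theta M x)"
    and tau_sigma_tau: "tau M (sigma M (tau M x)) = sigma M x"
    and theta_neq: "x \<in> crosses M \<Longrightarrow> theta M x \<noteq> x"
    and sigma_neq: "x \<in> crosses M \<Longrightarrow> sigma M x \<noteq> x"
    and theta_sigma_neq: "x \<in> crosses M \<Longrightarrow> theta M (sigma M x) \<noteq> x"
    and tau_neq_sigma: "x \<in> crosses M \<Longrightarrow> tau M x \<noteq> sigma M x"
    and even_empty_cycles: "even (empty_cycles M)"

text \<open>For maps, dualizing twice returns the rotation
  \<open>\<phi>\<sigma>\<theta> = \<tau>\<close>, so vertices and faces change places.\<close>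

definition dual_map :: "'a cmap \<Rightarrow> 'a cmap" where
  "dual_map M = \<lparr>crosses = crosses M, theta = sigma M, sigma = theta M, tau = phi M,
     empty_cycles = empty_cycles M\<rparr>"

lemma dual_map_simps [simp]:
  "crosses (dual_map M) = crosses M" "theta (dual_map M) = sigma M" "sigma (dual_map M) = theta M"
  "tau (dual_map M) = phi M" "empty_cycles (dual_map M) = empty_cycles M"
  by (simp_all add: dual_map_def)

lemma num_faces_dual: "num_vertices (dual_map M) = num_faces M"
  by (simp add: num_vertices_def num_faces_def)

definition vertex_at :: "'a cmap \<Rightarrow> 'a \<Rightarrow> 'a set set" where
  "vertex_at M a = {orbit (tau M) a, orbit (tau M) (sigma M a)}"

lemma num_vertices_alt: "num_vertices M = card (vertex_at M ` crosses M) + empty_cycles M div 2"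
  unfolding num_vertices_def vertex_at_def by (simp add: image_def Setcompr_eq_image)

lemma num_faces_alt: "num_faces M = card (vertex_at (dual_map M) ` crosses M) + empty_cycles M div 2"
  unfolding num_faces_dual[symmetric] num_vertices_alt by simp

context premap
begin

lemma theta_mem: "theta M x \<in> crosses M \<longleftrightarrow> x \<in> crosses M"
  and sigma_mem: "sigma M x \<in> crosses M \<longleftrightarrow> x \<in> crosses M"
  and tau_mem: "tau M x \<in> crosses M \<longleftrightarrow> x \<in> crosses M"
  using theta_permutes sigma_permutes tau_permutes by (simp_all add: permutes_in_image)

lemma phi_permutes: "phi M permutes crosses M"
  unfolding phi_def comp_assoc
  by (intro permutes_compose theta_permutes sigma_permutes tau_permutes)

lemma phi_apply: "phi M x = tau M (theta M (sigma M x))"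
  by (simp add: phi_def)

lemma premap_dual: "premap (dual_map M)"
proof
  fix x
  show "tau (dual_map M) (sigma (dual_map M) (tau (dual_map M) x)) = sigma (dual_map M) x"
    by (simp add: phi_apply theta_sigma[symmetric] sigma_sigma theta_theta)
      (simp add: theta_sigma sigma_sigma theta_theta tau_sigma_tau)
  assume x: "x \<in> crosses (dual_map M)"
  then show "tau (dual_map M) x \<noteq> sigma (dual_map M) x"
    using tau_neq_sigma[of "theta M (sigma M x)"]
    by (simp add: phi_apply theta_mem sigma_mem) (simp add: theta_sigma sigma_sigma)
qed (use theta_sigma_neq in \<open>auto simp: finite_crosses theta_permutes sigma_permutes phi_permutes
  theta_theta sigma_sigma theta_sigma theta_neq sigma_neq even_empty_cycles\<close>)

section \<open>Reflection of the cycles of \<open>\<tau>\<close> by \<open>\<sigma>\<close>\<close>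

lemma funpow_tau_sigma: "(tau M ^^ n) (sigma M ((tau M ^^ n) x)) = sigma M x"
proof (induction n arbitrary: x)
  case (Suc n)
  have "(tau M ^^ Suc n) (sigma M ((tau M ^^ Suc n) x))
      = tau M ((tau M ^^ n) (sigma M ((tau M ^^ n) (tau M x))))"
    by (simp add: funpow_swap1)
  then show ?case by (simp add: Suc tau_sigma_tau)
qed simp

text \<open>In \<open>\<tau>^n x = \<sigma> x = \<tau>\<sigma>\<tau> x\<close> one
  \<open>\<tau>\<close> cancels on the left, leaving
  \<open>\<tau>^(n-2) (\<tau> x) = \<sigma> (\<tau> x)\<close>. The exponent drops by two, down to
  the excluded cases 0 and 1. Thus the pointwise axiom yields the condition on orbits.\<close>

lemma funpow_tau_neq_sigma: "x \<in> crosses M \<Longrightarrow> (tau M ^^ n) x \<noteq> sigma M x"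
proof (induction n arbitrary: x rule: less_induct)
  case (less n)
  consider "n = 0" | "n = 1" | m where "n = Suc (Suc m)"
    by (metis One_nat_def not0_implies_Suc)
  then show ?case
  proof cases
    case 1
    then show ?thesis using sigma_neq[OF less.prems] by auto
  next
    case 2
    then show ?thesis using tau_neq_sigma[OF less.prems] by auto
  next
    case 3
    show ?thesis
    proof
      assume "(tau M ^^ n) x = sigma M x"
      then have "tau M ((tau M ^^ m) (tau M x)) = tau M (sigma M (tau M x))"
        by (simp add: 3 tau_sigma_tau funpow_swap1)
      then have "(tau M ^^ m) (tau M x) = sigma M (tau M x)"
        using permutes_inj[OF tau_permutes] by (simp add: inj_eq)
      then show False using less.IH[of m "tau M x"] less.prems 3 by (simp add: tau_mem)
    qed
  qed
qed

lemma sigma_notin_orbit: "x \<in> crosses M \<Longrightarrow> sigma M x \<notin> orbit (tau M) x"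
  by (auto simp: orbit_altdef dest: funpow_tau_neq_sigma[THEN not_sym])

lemma orbit_tau_self: "x \<in> orbit (tau M) x"
  using permutes_self_in_orbit[OF tau_permutes finite_crosses] .

lemma orbit_tau_eq: "y \<in> orbit (tau M) x \<Longrightarrow> orbit (tau M) y = orbit (tau M) x"
  using permutes_orbit_eq[OF tau_permutes finite_crosses] .

text \<open>\<open>\<sigma>\<close> conjugates \<open>\<tau>\<close> to its inverse, and a cycle run
  backwards has the same elements.\<close>

lemma sigma_orbit_tau: "sigma M ` orbit (tau M) x = orbit (tau M) (sigma M x)"
proof -
  have *: "sigma M y \<in> orbit (tau M) (sigma M x)" if "y \<in> orbit (tau M) x" for x y
  proof -
    obtain n where n: "y = (tau M ^^ n) x" "n > 0" using \<open>y \<in> orbit (tau M) x\<close> by (auto simp: orbit_altdef)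
    then have "sigma M x \<in> orbit (tau M) (sigma M y)"
      using funpow_tau_sigma[of n x] by (auto simp: orbit_altdef intro!: exI[of _ n])
    then show ?thesis using orbit_tau_eq orbit_tau_self by metis
  qed
  show ?thesis
  proof (intro equalityI subsetI)
    fix y assume "y \<in> orbit (tau M) (sigma M x)"
    then have "sigma M y \<in> orbit (tau M) x" using *[of y "sigma M x"] by (simp add: sigma_sigma)
    then show "y \<in> sigma M ` orbit (tau M) x" by (metis image_eqI sigma_sigma)
  qed (use * in auto)
qed

lemma vertex_at_alt: "vertex_at M x = {orbit (tau M) x, sigma M ` orbit (tau M) x}"
  by (simp add: vertex_at_def sigma_orbit_tau)

lemma sigma_image_orbit_neq: "x \<in> crosses M \<Longrightarrow> sigma M ` orbit (tau M) x \<noteq> orbit (tau M) x"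
  using sigma_notin_orbit orbit_tau_self by blast

lemma sigma_image_sigma_image: "sigma M ` sigma M ` X = X"
  by (simp add: image_image sigma_sigma)

text \<open>\<open>\<sigma>\<close> permutes these cycles in pairs. Deletion turns them into empty
  cycles, whose number has to stay even.\<close>

lemma even_card_orbits_within:
  assumes "\<And>x. x \<in> e \<Longrightarrow> sigma M x \<in> e"
  shows "even (card {orbit (tau M) a |a. a \<in> crosses M \<and> orbit (tau M) a \<subseteq> e})"
proof -
  let ?P = "{orbit (tau M) a |a. a \<in> crosses M \<and> orbit (tau M) a \<subseteq> e}"
  have "2 * card ((\<lambda>X. {X, sigma M ` X}) ` ?P) = card ?P"
  proof (rule card_involution_pairs)
    show "finite ?P" using finite_crosses by simp
    fix X assume "X \<in> ?P"
    then obtain a where a: "X = orbit (tau M) a" "a \<in> crosses M" "orbit (tau M) a \<subseteq> e" by blast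
    then show "sigma M ` X \<noteq> X" using sigma_image_orbit_neq by simp
    have "orbit (tau M) (sigma M a) \<subseteq> e" using a assms by (auto simp flip: sigma_orbit_tau)
    then show "sigma M ` X \<in> ?P" using a by (auto simp: sigma_orbit_tau sigma_mem)
  qed (simp add: sigma_image_sigma_image)
  from this[symmetric] show ?thesis by simp
qed

lemma twice_card_vertices: "2 * card (vertex_at M ` crosses M) = num_cycles (tau M) (crosses M)"
proof -
  let ?P = "orbit (tau M) ` crosses M"
  have "2 * card ((\<lambda>X. {X, sigma M ` X}) ` ?P) = card ?P"
    using finite_crosses sigma_image_orbit_neq
    by (intro card_involution_pairs) (auto simp: sigma_orbit_tau sigma_sigma sigma_mem)
  moreover have "(\<lambda>X. {X, sigma M ` X}) ` ?P = vertex_at M ` crosses M"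
    by (simp add: image_image vertex_at_alt)
  ultimately show ?thesis by (simp add: num_cycles_def)
qed

lemma map_edge_mem: "y \<in> map_edge M x \<Longrightarrow> map_edge M y = map_edge M x"
  by (auto simp: map_edge_def theta_theta sigma_sigma theta_sigma)

lemma map_edge_subset: "x \<in> crosses M \<Longrightarrow> map_edge M x \<subseteq> crosses M"
  by (auto simp: map_edge_def theta_mem sigma_mem)

text \<open>\<open>\<theta>\<close> and \<open>\<sigma>\<close> generate a Klein four-group acting
  freely on the crosses, and the edges are its orbits.\<close>

lemma four_num_edges: "4 * num_edges M = card (crosses M)"
proof -
  have "4 * card (edges M) = card (\<Union>(edges M))"
  proof (rule card_partition)
    show "finite (edges M)" using finite_crosses by (simp add: edges_def)
    show "finite (\<Union>(edges M))"
      using finite_crosses map_edge_subset by (auto simp: edges_def map_edge_def)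
    show "card c = 4" if c: "c \<in> edges M" for c
    proof -
      obtain x where x: "x \<in> crosses M" "c = map_edge M x" using c by (auto simp: edges_def)
      have "theta M x \<noteq> sigma M x" "theta M x \<noteq> theta M (sigma M x)" "sigma M x \<noteq> theta M (sigma M x)"
        using theta_sigma_neq[OF x(1)] sigma_neq[OF x(1)] theta_neq[of "sigma M x"] x
        by (metis theta_theta sigma_sigma sigma_mem)+
      then show ?thesis
        using x theta_neq[OF x(1)] sigma_neq[OF x(1)] theta_sigma_neq[OF x(1)]
        by (auto simp: map_edge_def card_insert_if)
    qed
    show "c1 \<inter> c2 = {}" if "c1 \<in> edges M" "c2 \<in> edges M" "c1 \<noteq> c2" for c1 c2
      using that map_edge_mem unfolding edges_def by blast
  qed
  moreover have "\<Union>(edges M) = crosses M"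
    using map_edge_subset by (auto simp: edges_def) (auto simp: map_edge_def)
  ultimately show ?thesis by (simp add: num_edges_def)
qed

text \<open>Stated for an invariant subset, because the parity argument uses it on half of the
  crosses.\<close>

lemma twice_num_cycles_theta_sigma:
  assumes "A \<subseteq> crosses M" "\<And>x. x \<in> A \<Longrightarrow> theta M (sigma M x) \<in> A"
  shows "2 * card (orbit (theta M \<circ> sigma M) ` A) = card A"
proof -
  let ?i = "theta M \<circ> sigma M"
  have "orbit ?i x = {x, ?i x}" for x
  proof
    have "?i (?i x) = x" for x by (simp add: theta_sigma theta_theta sigma_sigma)
    then have "x \<in> orbit ?i x" using orbit.base[of ?i x] orbit.step[of "?i x" ?i x] by metis
    then show "{x, ?i x} \<subseteq> orbit ?i x" by (auto intro: orbit.base simp del: o_apply)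
    show "orbit ?i x \<subseteq> {x, ?i x}"
      using \<open>\<And>x. ?i (?i x) = x\<close> by (intro orbit_closed_subset) auto
  qed
  then have "orbit ?i ` A = (\<lambda>x. {x, ?i x}) ` A" by simp
  moreover have "2 * card ((\<lambda>x. {x, ?i x}) ` A) = card A"
    using assms theta_sigma_neq finite_subset[OF assms(1) finite_crosses]
    by (intro card_involution_pairs)
      (auto simp: theta_sigma theta_theta sigma_sigma simp flip: theta_sigma[of "sigma M _"])
  ultimately show ?thesis by simp
qed

end

section \<open>Deletion and contraction\<close>

text \<open>This is the rotation after deletion. For a permutation of a finite set and
  \<open>b \<notin> e\<close> the minimum exists, because \<open>b\<close> itself recurs.\<close>

definition first_return :: "('a \<Rightarrow> 'a) \<Rightarrow> 'a set \<Rightarrow> 'a \<Rightarrow> 'a" where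
  "first_return p e b = (p ^^ (LEAST j. j \<ge> 1 \<and> (p ^^ j) b \<notin> e)) b"

lemma first_return_eqI:
  assumes "n \<ge> 1" "(p ^^ n) b \<notin> e" "\<And>i. 1 \<le> i \<Longrightarrow> i < n \<Longrightarrow> (p ^^ i) b \<in> e"
  shows "first_return p e b = (p ^^ n) b"
proof -
  have "(LEAST j. j \<ge> 1 \<and> (p ^^ j) b \<notin> e) = n"
    using assms by (intro Least_equality) (auto simp: not_le[symmetric])
  then show ?thesis by (simp add: first_return_def)
qed

lemma first_return_ex:
  assumes "p permutes C" "finite C" "b \<notin> e"
  shows "\<exists>n\<ge>1. (p ^^ n) b \<notin> e \<and> (\<forall>i. 1 \<le> i \<and> i < n \<longrightarrow> (p ^^ i) b \<in> e)
    \<and> first_return p e b = (p ^^ n) b"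
proof -
  obtain m where m: "m \<ge> 1 \<and> (p ^^ m) b \<notin> e"
    using permutes_self_in_orbit[OF assms(1,2), of b] assms(3)
    by (auto simp: orbit_altdef Suc_le_eq intro: that)
  define n where "n = (LEAST j. j \<ge> 1 \<and> (p ^^ j) b \<notin> e)"
  have "n \<ge> 1 \<and> (p ^^ n) b \<notin> e" unfolding n_def by (rule LeastI_ex) (use m in blast)
  moreover have "(p ^^ i) b \<in> e" if "1 \<le> i" "i < n" for i
    using not_less_Least[of i "\<lambda>j. j \<ge> 1 \<and> (p ^^ j) b \<notin> e"] that by (auto simp: n_def)
  moreover have "first_return p e b = (p ^^ n) b" by (simp add: first_return_def n_def)
  ultimately show ?thesis by blast
qed

lemma delete_edge_simps [simp]:
  "crosses (delete_edge M e) = crosses M - e"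
  "theta (delete_edge M e) = perm_restrict (theta M) (crosses M - e)"
  "sigma (delete_edge M e) = perm_restrict (sigma M) (crosses M - e)"
  "tau (delete_edge M e) = perm_restrict (first_return (tau M) e) (crosses M - e)"
  "empty_cycles (delete_edge M e) = empty_cycles M
     + card {orbit (tau M) a |a. a \<in> crosses M \<and> orbit (tau M) a \<subseteq> e}"
  by (simp_all add: delete_edge_def Let_def first_return_def[abs_def])

lemma perm_restrict_permutes:
  assumes "p permutes C" "finite A" "\<And>x. x \<in> A \<Longrightarrow> p x \<in> A"
  shows "perm_restrict p A permutes A"
proof (rule bij_imp_permutes)
  have "p ` A = A"
    using assms permutes_inj_on[OF assms(1)] by (intro card_subset_eq) (auto simp: card_image)
  then show "bij_betw (perm_restrict p A) A A"
    using permutes_inj_on[OF assms(1)]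
    by (auto simp: bij_betw_def perm_restrict_def inj_on_def)
qed (simp add: perm_restrict_def)

context premap
begin

lemma first_return_mem:
  assumes "x \<in> crosses M - e"
  shows "first_return (tau M) e x \<in> crosses M - e"
    and "first_return (tau M) e x \<in> orbit (tau M) x"
proof -
  obtain n where n: "n \<ge> 1" "(tau M ^^ n) x \<notin> e" "first_return (tau M) e x = (tau M ^^ n) x"
    using first_return_ex[OF tau_permutes finite_crosses, of x e] assms by blast
  show orb: "first_return (tau M) e x \<in> orbit (tau M) x"
    using n by (auto simp: orbit_altdef)
  then show "first_return (tau M) e x \<in> crosses M - e"
    using n permutes_orbit_subset[OF tau_permutes] assms by auto
qed

text \<open>\<open>\<sigma>\<close> reflects the path \<open>x, \<tau> x, ..., \<tau>^n x\<close>.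
  From \<open>\<sigma> (\<tau>^n x)\<close> the iterates of \<open>\<tau>\<close> retrace the mirror
  image, staying in \<open>e\<close> until they reach \<open>\<sigma> x\<close> after the same
  \<open>n\<close> steps.\<close>

lemma first_return_sigma_first_return:
  assumes "x \<in> crosses M - e" "\<And>y. sigma M y \<in> e \<longleftrightarrow> y \<in> e"
  shows "first_return (tau M) e (sigma M (first_return (tau M) e x)) = sigma M x"
proof -
  have "x \<notin> e" using assms(1) by simp
  obtain n where n: "n \<ge> 1" "(tau M ^^ n) x \<notin> e"
    "\<And>i. 1 \<le> i \<Longrightarrow> i < n \<Longrightarrow> (tau M ^^ i) x \<in> e"
    "first_return (tau M) e x = (tau M ^^ n) x"
    using first_return_ex[OF tau_permutes finite_crosses \<open>x \<notin> e\<close>] by blast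
  have iter: "(tau M ^^ i) (sigma M ((tau M ^^ n) x)) = sigma M ((tau M ^^ (n - i)) x)"
    if "i \<le> n" for i
  proof -
    have "(tau M ^^ n) x = (tau M ^^ i) ((tau M ^^ (n - i)) x)"
      using that funpow_add[of i "n - i" "tau M"] by simp
    then show ?thesis using funpow_tau_sigma[of i "(tau M ^^ (n - i)) x"] by simp
  qed
  have "first_return (tau M) e (sigma M ((tau M ^^ n) x)) = (tau M ^^ n) (sigma M ((tau M ^^ n) x))"
    using n assms iter by (intro first_return_eqI) auto
  then show ?thesis using n iter[of n] by simp
qed

lemma premap_delete:
  assumes theta_e: "\<And>x. theta M x \<in> e \<longleftrightarrow> x \<in> e" and sigma_e: "\<And>x. sigma M x \<in> e \<longleftrightarrow> x \<in> e"
  shows "premap (delete_edge M e)"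
proof
  let ?C = "crosses M - e" and ?r = "first_return (tau M) e"
  note ret = first_return_mem
  have fin: "finite ?C" using finite_crosses by simp
  show "finite (crosses (delete_edge M e))" using fin by simp
  show "theta (delete_edge M e) permutes crosses (delete_edge M e)"
    "sigma (delete_edge M e) permutes crosses (delete_edge M e)"
    using perm_restrict_permutes[OF theta_permutes fin] perm_restrict_permutes[OF sigma_permutes fin]
    by (simp_all add: theta_e sigma_e theta_mem sigma_mem)
  have sC: "sigma M x \<in> ?C \<longleftrightarrow> x \<in> ?C" for x by (simp add: sigma_e sigma_mem)
  have rsr: "?r (sigma M (?r x)) = sigma M x" if "x \<in> ?C" for x
    using first_return_sigma_first_return[OF that sigma_e] .
  \<comment> \<open>The relation \<open>rsr\<close> exhibits a preimage of every \<open>y\<close>;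
    on the finite set \<open>?C\<close> surjectivity then yields injectivity.\<close>
  have "?C \<subseteq> ?r ` ?C"
  proof
    fix y assume "y \<in> ?C"
    then have s: "sigma M y \<in> ?C" using sC by blast
    then have "y = ?r (sigma M (?r (sigma M y)))" using rsr[of "sigma M y"] by (simp add: sigma_sigma)
    moreover have "sigma M (?r (sigma M y)) \<in> ?C" using ret(1)[OF s] sC by blast
    ultimately show "y \<in> ?r ` ?C" by blast
  qed
  then have "inj_on ?r ?C" "?r ` ?C = ?C"
    using finite_surj_inj[OF fin] ret(1) by blast+
  then show "tau (delete_edge M e) permutes crosses (delete_edge M e)"
    by (auto intro!: bij_imp_permutes simp: bij_betw_def perm_restrict_def inj_on_def)
  fix x
  show "theta (delete_edge M e) (theta (delete_edge M e) x) = x"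
    "sigma (delete_edge M e) (sigma (delete_edge M e) x) = x"
    "theta (delete_edge M e) (sigma (delete_edge M e) x) = sigma (delete_edge M e) (theta (delete_edge M e) x)"
    by (auto simp add: perm_restrict_def theta_e sigma_e theta_mem sigma_mem theta_theta sigma_sigma theta_sigma)
  show "tau (delete_edge M e) (sigma (delete_edge M e) (tau (delete_edge M e) x)) = sigma (delete_edge M e) x"
  proof (cases "x \<in> ?C")
    case True
    then have "?r x \<in> ?C" "sigma M (?r x) \<in> ?C" using ret(1) sC by blast+
    then show ?thesis using True rsr by (simp add: perm_restrict_simps del: Diff_iff)
  qed (simp add: perm_restrict_simps del: Diff_iff)
  show "even (empty_cycles (delete_edge M e))"
    using even_empty_cycles even_card_orbits_within[of e] sigma_e by simp
  assume "x \<in> crosses (delete_edge M e)"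
  then have x: "x \<in> ?C" "x \<in> crosses M" by simp_all
  show "theta (delete_edge M e) x \<noteq> x" "sigma (delete_edge M e) x \<noteq> x"
    "theta (delete_edge M e) (sigma (delete_edge M e) x) \<noteq> x"
    using x sC theta_neq sigma_neq theta_sigma_neq by (auto simp: perm_restrict_simps simp del: Diff_iff)
  \<comment> \<open>The first return stays in the cycle of \<open>x\<close> under
    \<open>\<tau>\<close>, which does not contain \<open>\<sigma> x\<close>.\<close>
  show "tau (delete_edge M e) x \<noteq> sigma (delete_edge M e) x"
    using x(1) ret(2)[OF x(1)] sigma_notin_orbit[OF x(2)] by (auto simp: perm_restrict_simps simp del: Diff_iff)
qed

lemma edge_closed:
  assumes "e \<in> edges M"
  shows "e \<subseteq> crosses M" "theta M x \<in> e \<longleftrightarrow> x \<in> e" "sigma M x \<in> e \<longleftrightarrow> x \<in> e"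
proof -
  obtain a where a: "a \<in> crosses M" "e = map_edge M a" using assms by (auto simp: edges_def)
  then show "e \<subseteq> crosses M" using map_edge_subset by simp
  show "theta M x \<in> e \<longleftrightarrow> x \<in> e" "sigma M x \<in> e \<longleftrightarrow> x \<in> e"
    unfolding a(2) map_edge_def insert_iff empty_iff
    by (metis theta_theta sigma_sigma theta_sigma)+
qed

text \<open>
  Contraction is dual to deletion. A cycle of \<open>\<phi>\<close> contains at most two crosses of an edge, since it
  contains \<open>b\<close> and \<open>\<theta> b\<close> for no \<open>b\<close>; so the first return takes at most three steps.
\<close>

lemma contract_edge_dual:
  assumes e: "e \<in> edges M"
  shows "contract_edge M e = dual_map (delete_edge (dual_map M) e)"
proof -
  interpret D: premap "dual_map M" by (rule premap_dual)
  let ?C = "crosses M - e" and ?p = "phi M" and ?r = "theta M \<circ> sigma M \<circ> tau M"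
  note closed = edge_closed[OF e]
  have "(if tau M b \<notin> e then tau M b else if tau M (?r b) \<notin> e then tau M (?r b) else tau M (?r (?r b)))
      = phi (delete_edge (dual_map M) e) b" if b: "b \<in> ?C" for b
  proof -
    \<comment> \<open>The rotation of the dual of the deletion is the first return of
      \<open>\<phi>\<close> applied after \<open>\<theta>\<sigma>\<close>. So the walk starts at
      \<open>\<theta>\<sigma> b\<close>, and its first step leads to
      \<open>\<tau> b\<close>.\<close>
    define b' where "b' = theta M (sigma M b)"
    have C: "sigma M b \<in> ?C" "theta M (sigma M b) \<in> ?C" "theta M b \<in> ?C"
      using b closed(2,3) by (simp_all add: theta_mem sigma_mem)
    have rhs: "phi (delete_edge (dual_map M) e) b = first_return ?p e b'"
      unfolding b'_def using b C by (simp add: phi_def[of "delete_edge _ _"] perm_restrict_simps theta_sigma del: Diff_iff)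
    have pb: "?p b' = tau M b"
      by (simp add: b'_def phi_apply theta_sigma theta_theta sigma_sigma)
    have pr: "?p x = tau M (theta M (sigma M x))" for x by (simp add: phi_apply)
    have p1: "(?p ^^ Suc 0) b' = tau M b" by (simp add: pb)
    have p2: "(?p ^^ Suc (Suc 0)) b' = tau M (?r b)" by (simp add: pb) (simp add: pr)
    have p3: "(?p ^^ Suc (Suc (Suc 0))) b' = tau M (?r (?r b))" by (simp add: pb) (simp add: pr)
    have step: "i = Suc 0 \<or> i = Suc (Suc 0)" if "1 \<le> i" "i < Suc (Suc (Suc 0))" for i
      using that by arith
    show ?thesis
    proof (cases "tau M b \<in> e")
      case False
      then have "first_return ?p e b' = (?p ^^ Suc 0) b'"
        by (intro first_return_eqI) (simp_all only: p1, simp_all)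
      then show ?thesis using False by (simp only: rhs p1 simp_thms if_True)
    next
      case c: True
      show ?thesis
      proof (cases "tau M (?r b) \<in> e")
        case False
        then have "first_return ?p e b' = (?p ^^ Suc (Suc 0)) b'"
          using c p1 by (intro first_return_eqI) (simp_all only: p2, simp_all add: less_Suc_eq)
        then show ?thesis using False c by (simp only: rhs p2 simp_thms if_True if_False)
      next
        case d: True
        let ?c = "tau M b" and ?d = "tau M (?r b)"
        have dc: "?d = ?p ?c" by (simp add: pr)
        have inj: "?p x = ?p y \<longleftrightarrow> x = y" for x y
          using permutes_inj[OF phi_permutes] by (simp add: inj_eq)
        have neq: "theta M x \<notin> orbit ?p x" if "x \<in> e" for x
          using D.sigma_notin_orbit[of x] that closed(1) by auto
        have pe: "b' \<notin> e" using C b'_def by blast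
        have cd: "?c \<noteq> ?d" using dc pb inj pe c by metis
        \<comment> \<open>Otherwise \<open>?c\<close>, \<open>?d\<close> and \<open>?p ?d\<close>
          would be three distinct crosses of \<open>e\<close> on one cycle of \<open>\<phi>\<close>,
          none of them the image of another under \<open>\<theta>\<close>. But \<open>e\<close>
          consists of only two pairs \<open>{x, \<theta> x}\<close>.\<close>
        have "?p ?d \<notin> e"
        proof
          assume f: "?p ?d \<in> e"
          have orb: "?d \<in> orbit ?p ?c" "?p ?d \<in> orbit ?p ?c" "?p ?d \<in> orbit ?p ?d"
            unfolding dc by (auto intro: orbit.intros)
          have e_eq: "e = map_edge M ?c"
            using e c map_edge_mem by (auto simp: edges_def)
          have "?d \<noteq> theta M ?c" "?p ?d \<noteq> theta M ?c" "?p ?d \<noteq> theta M ?d"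
            using neq[OF c] neq[OF d] orb by auto
          moreover have "?p ?d \<noteq> ?d" using dc inj cd by metis
          moreover have "?p ?d \<noteq> ?c" using pb inj pe d by metis
          ultimately show False
            using cd d f unfolding e_eq map_edge_def insert_iff empty_iff
            by (metis theta_theta theta_sigma)
        qed
        then have "first_return ?p e b' = (?p ^^ Suc (Suc (Suc 0))) b'"
        proof (intro first_return_eqI)
          show "(?p ^^ Suc (Suc (Suc 0))) b' \<notin> e"
            using \<open>?p ?d \<notin> e\<close> unfolding p3 pr by simp
          show "(?p ^^ i) b' \<in> e" if "1 \<le> i" "i < Suc (Suc (Suc 0))" for i
            using step[OF that] p1 p2 c d by metis
        qed simp
        then show ?thesis using c d by (simp only: rhs p3 simp_thms if_False)
      qed
    qed
  qed
  moreover have "phi (delete_edge (dual_map M) e) b = b" if "b \<notin> ?C" for b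
    using that by (simp add: phi_def[of "delete_edge _ _"] perm_restrict_simps del: Diff_iff)
  ultimately have "tau (contract_edge M e) = phi (delete_edge (dual_map M) e)"
    by (auto simp: fun_eq_iff contract_edge_def Let_def perm_restrict_def)
  then show ?thesis
    by (simp add: dual_map_def[of "delete_edge _ _"]) (simp add: contract_edge_def Let_def)
qed

lemma premap_contract:
  assumes "e \<in> edges M"
  shows "premap (contract_edge M e)"
proof -
  interpret D: premap "dual_map M" by (rule premap_dual)
  have "premap (delete_edge (dual_map M) e)"
    by (rule D.premap_delete) (simp_all add: edge_closed[OF assms])
  then show ?thesis unfolding contract_edge_dual[OF assms] by (rule premap.premap_dual)
qed

text \<open>\<open>N\<close> stands for the deletion as well as for the contraction, since both
  restrict \<open>\<theta>\<close> and \<open>\<sigma>\<close> alike. In the inductions over lists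
  it keeps the remaining entries edges of the smaller map.\<close>

lemma edges_diff_subset:
  assumes e: "e \<in> edges M" and N: "crosses N = crosses M - e"
    "theta N = perm_restrict (theta M) (crosses M - e)" "sigma N = perm_restrict (sigma M) (crosses M - e)"
  shows "edges M - {e} \<subseteq> edges N"
proof
  fix f assume f: "f \<in> edges M - {e}"
  then obtain a where a: "a \<in> crosses M" "f = map_edge M a" by (auto simp: edges_def)
  have "a \<notin> e" using f a e map_edge_mem by (auto simp: edges_def)
  then have "a \<in> crosses M - e" "sigma M a \<in> crosses M - e"
    using a edge_closed[OF e] by (simp_all add: sigma_mem)
  then have "map_edge N a = f" "a \<in> crosses N"
    using a by (simp_all add: map_edge_def N perm_restrict_simps del: Diff_iff)
  then show "f \<in> edges N" by (auto simp: edges_def)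
qed

end

section \<open>Contraction of a set of edges\<close>

lemma premap_foldl_contract:
  assumes "premap M" "distinct es" "set es \<subseteq> edges M"
  shows "premap (foldl contract_edge M es)"
  using assms
proof (induction es arbitrary: M)
  case (Cons e es)
  interpret premap M by fact
  have e: "e \<in> edges M" using Cons.prems by simp
  have "edges M - {e} \<subseteq> edges (contract_edge M e)"
    by (rule edges_diff_subset[OF e]) (simp_all add: contract_edge_def Let_def)
  then show ?case using Cons.IH[OF premap_contract[OF e]] Cons.prems by auto
qed simp

lemma premap_contract_edges:
  assumes "premap M" "B \<subseteq> edges M"
  shows "premap (contract_edges M B)"
proof -
  have "finite B"
    using assms premap.finite_crosses[OF assms(1)] by (auto simp: edges_def intro: finite_subset)
  then have "\<exists>es. distinct es \<and> set es = B" using finite_distinct_list by blast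
  from someI_ex[OF this] show ?thesis
    unfolding contract_edges_def using assms by (intro premap_foldl_contract) auto
qed

section \<open>Maps as unions of connected maps\<close>

lemma premap_empty: "premap empty_map"
  by unfold_locales (auto simp: empty_map_def permutes_id)

lemma premap_connected:
  assumes "connected_map N"
  shows "premap N"
proof (cases "N = isolated_vertex")
  case True
  then show ?thesis by unfold_locales (auto simp: isolated_vertex_def permutes_id)
next
  case False
  note N = assms[unfolded connected_map_def Let_def]
  have perm: "tau N permutes crosses N" "finite (crosses N)" using N False by auto
  have ts: "tau N \<circ> sigma N = sigma N \<circ> inv_into UNIV (tau N)" using N False by auto
  have dist: "distinct [a, theta N a, sigma N a, theta N (sigma N a)]"
    and orb: "orbit (tau N) a \<noteq> orbit (tau N) (sigma N a)" if "a \<in> crosses N" for a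
    using N False that by auto
  show ?thesis
  proof
    fix x
    show "theta N (theta N x) = x" "sigma N (sigma N x) = x" "theta N (sigma N x) = sigma N (theta N x)"
      using N False unfolding fun_eq_iff o_apply id_apply by blast+
    show "tau N (sigma N (tau N x)) = sigma N x"
      using fun_cong[OF ts, of "tau N x"] permutes_inj[OF perm(1)] by simp
    assume x: "x \<in> crosses N"
    show "theta N x \<noteq> x" "sigma N x \<noteq> x" "theta N (sigma N x) \<noteq> x"
      using dist[OF x] by auto
    show "tau N x \<noteq> sigma N x"
      using orb[OF x] permutes_orbit_eq[OF perm orbit.base[of "tau N" x]] by metis
  qed (use N False in auto)
qed

lemma premap_union:
  assumes "premap M" "premap N" and disj: "crosses M \<inter> crosses N = {}"
  shows "premap (map_union M N)"
proof -
  interpret M: premap M by fact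
  interpret N: premap N by fact
  have NM: "theta N x = x" "sigma N x = x" "tau N x = x" if "x \<in> crosses M" for x
    using that disj permutes_not_in[OF N.theta_permutes] permutes_not_in[OF N.sigma_permutes]
      permutes_not_in[OF N.tau_permutes] by blast+
  have MN: "theta M x = x" "sigma M x = x" "tau M x = x" if "x \<notin> crosses M" for x
    using that permutes_not_in[OF M.theta_permutes] permutes_not_in[OF M.sigma_permutes]
      permutes_not_in[OF M.tau_permutes] by blast+
  have N_mem: "theta N x \<notin> crosses M" "sigma N x \<notin> crosses M" "tau N x \<notin> crosses M"
    if "x \<notin> crosses M" for x
    using that disj N.theta_mem N.sigma_mem N.tau_mem NM M.theta_mem
      permutes_not_in[OF N.theta_permutes] permutes_not_in[OF N.sigma_permutes]
      permutes_not_in[OF N.tau_permutes]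
    by (metis disjoint_iff)+
  note mem = M.theta_mem M.sigma_mem M.tau_mem
  show ?thesis
  proof
    show "finite (crosses (map_union M N))"
      by (simp add: map_union_def M.finite_crosses N.finite_crosses)
    show "theta (map_union M N) permutes crosses (map_union M N)"
      "sigma (map_union M N) permutes crosses (map_union M N)"
      "tau (map_union M N) permutes crosses (map_union M N)"
      unfolding map_union_def
      by (auto intro!: permutes_compose
          intro: permutes_subset M.theta_permutes M.sigma_permutes M.tau_permutes
            N.theta_permutes N.sigma_permutes N.tau_permutes)
    show "even (empty_cycles (map_union M N))"
      by (simp add: map_union_def M.even_empty_cycles N.even_empty_cycles)
    fix x
    show "theta (map_union M N) (theta (map_union M N) x) = x"
      "sigma (map_union M N) (sigma (map_union M N) x) = x"
      "theta (map_union M N) (sigma (map_union M N) x) = sigma (map_union M N) (theta (map_union M N) x)"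
      "tau (map_union M N) (sigma (map_union M N) (tau (map_union M N) x)) = sigma (map_union M N) x"
      by (cases "x \<in> crosses M"; simp add: map_union_def NM MN N_mem mem M.theta_theta N.theta_theta
          M.sigma_sigma N.sigma_sigma M.theta_sigma N.theta_sigma M.tau_sigma_tau N.tau_sigma_tau)+
    assume "x \<in> crosses (map_union M N)"
    then consider "x \<in> crosses M" | "x \<notin> crosses M" "x \<in> crosses N" by (auto simp: map_union_def)
    then show "theta (map_union M N) x \<noteq> x" "sigma (map_union M N) x \<noteq> x"
      "theta (map_union M N) (sigma (map_union M N) x) \<noteq> x"
      "tau (map_union M N) x \<noteq> sigma (map_union M N) x"
      by (cases; simp add: map_union_def NM MN N_mem mem M.theta_neq M.sigma_neq M.theta_sigma_neq
          M.tau_neq_sigma N.theta_neq N.sigma_neq N.theta_sigma_neq N.tau_neq_sigma)+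
  qed
qed

lemma is_map_premap: "is_map M \<Longrightarrow> premap M"
  by (induction rule: is_map.induct) (auto intro: premap_empty premap_union premap_connected)

section \<open>Euler genus\<close>

lemma num_components_alt:
  "num_components M =
    card (group_orbits {theta M, sigma M, tau M} (crosses M)) + empty_cycles M div 2"
  by (simp add: num_components_def components_def)

context premap
begin

section \<open>The group \<open>\<langle>\<theta>, \<sigma>, \<tau>\<rangle>\<close> and its
  subgroup \<open>\<langle>\<theta>\<sigma>, \<tau>\<rangle>\<close>\<close>

abbreviation generators :: "('a \<Rightarrow> 'a) set" where
  "generators \<equiv> {theta M, sigma M, tau M}"

abbreviation oriented_generators :: "('a \<Rightarrow> 'a) set" where
  "oriented_generators \<equiv> {theta M \<circ> sigma M, tau M}"

lemma theta_sigma_permutes: "theta M \<circ> sigma M permutes crosses M"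
  by (intro permutes_compose theta_permutes sigma_permutes)

lemma generators_permute: "\<forall>h\<in>generators. h permutes crosses M"
  using theta_permutes sigma_permutes tau_permutes by simp

lemma oriented_generators_permute: "\<forall>h\<in>oriented_generators. h permutes crosses M"
  using theta_sigma_permutes tau_permutes by simp

lemmas generators_bij = permutes_imp_bij_all[OF generators_permute]
lemmas oriented_generators_bij = permutes_imp_bij_all[OF oriented_generators_permute]

lemma generators_orbit_subset: "a \<in> crosses M \<Longrightarrow> group_orbit generators a \<subseteq> crosses M"
  by (rule group_orbit_subset_carrier[OF generators_permute finite_crosses])

lemma oriented_orbit_subset: "a \<in> crosses M \<Longrightarrow> group_orbit oriented_generators a \<subseteq> crosses M"
  by (rule group_orbit_subset_carrier[OF oriented_generators_permute finite_crosses])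

lemma generators_orbit_step:
  assumes "b \<in> group_orbit generators a"
  shows "theta M b \<in> group_orbit generators a" "sigma M b \<in> group_orbit generators a"
    "tau M b \<in> group_orbit generators a"
  using assms by (auto intro: group_orbit_step[OF generators_bij])

lemma oriented_orbit_step:
  assumes "b \<in> group_orbit oriented_generators a"
  shows "theta M (sigma M b) \<in> group_orbit oriented_generators a"
    "tau M b \<in> group_orbit oriented_generators a"
  using group_orbit_step[OF oriented_generators_bij _ assms, of "theta M \<circ> sigma M"]
    group_orbit_step[OF oriented_generators_bij _ assms, of "tau M"] by simp_all

text \<open>Conjugation by \<open>\<sigma>\<close> preserves \<open>\<theta>\<sigma>\<close> and
  inverts \<open>\<tau>\<close>, so it normalizes the group they generate.\<close>

lemma sigma_oriented_orbit:
  assumes a: "a \<in> crosses M" and b: "b \<in> group_orbit oriented_generators a"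
  shows "sigma M b \<in> group_orbit oriented_generators (sigma M a)"
proof -
  let ?O = "group_orbit oriented_generators (sigma M a)"
  have U: "?O \<subseteq> crosses M" using oriented_orbit_subset a by (simp add: sigma_mem)
  have fin: "finite ?O" using U finite_crosses finite_subset by blast
  \<comment> \<open>Since \<open>\<sigma>\<tau>\<close> is the inverse of \<open>\<tau>\<close>
    after \<open>\<sigma>\<close>, the orbit must be closed under that inverse too.\<close>
  have tau_iff: "tau M x \<in> ?O \<longleftrightarrow> x \<in> ?O" for x
    using permutes_mem_closed_iff[OF tau_permutes fin] oriented_orbit_step(2) by blast
  have "group_orbit oriented_generators a \<subseteq> {b \<in> crosses M. sigma M b \<in> ?O}"
  proof (rule group_orbit_subset[OF oriented_generators_permute])
    fix h x assume h: "h \<in> oriented_generators" and x: "x \<in> {b \<in> crosses M. sigma M b \<in> ?O}"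
    have "sigma M (theta M (sigma M x)) = theta M (sigma M (sigma M x))"
      by (simp add: theta_sigma)
    then have "sigma M (theta M (sigma M x)) \<in> ?O" using oriented_orbit_step(1) x by auto
    moreover have "sigma M (tau M x) \<in> ?O"
      using tau_iff[of "sigma M (tau M x)"] x by (simp add: tau_sigma_tau)
    ultimately show "h x \<in> {b \<in> crosses M. sigma M b \<in> ?O}"
      using h x by (auto simp: theta_mem sigma_mem tau_mem)
  qed (use a group_orbit_self finite_crosses in auto)
  then show ?thesis using b by blast
qed

text \<open>As \<open>\<theta> = (\<theta>\<sigma>)\<sigma>\<close>, adjoining
  \<open>\<sigma>\<close> to \<open>\<langle>\<theta>\<sigma>, \<tau>\<rangle>\<close> gives the
  whole group; \<open>\<sigma>\<close> normalizes this subgroup and is an involution, so two of its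
  orbits cover a full orbit.\<close>

lemma generators_orbit_cases:
  assumes a: "a \<in> crosses M" and x: "x \<in> group_orbit generators a"
  shows "x \<in> group_orbit oriented_generators a \<or> x \<in> group_orbit oriented_generators (sigma M a)"
proof -
  let ?A = "group_orbit oriented_generators a \<union> group_orbit oriented_generators (sigma M a)"
  have sa: "sigma M a \<in> crosses M" using a by (simp add: sigma_mem)
  have "group_orbit generators a \<subseteq> ?A"
  proof (rule group_orbit_subset[OF generators_permute])
    show "finite ?A"
      using oriented_orbit_subset a sa finite_crosses finite_subset by blast
    fix h y assume h: "h \<in> generators" and y: "y \<in> ?A"
    have s: "sigma M z \<in> ?A" if "z \<in> ?A" for z
      using that sigma_oriented_orbit[OF a, of z] sigma_oriented_orbit[OF sa, of z]
      by (auto simp: sigma_sigma)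
    have "theta M (sigma M (sigma M y)) \<in> ?A" "tau M y \<in> ?A"
      using s[OF y] y oriented_orbit_step by blast+
    then show "h y \<in> ?A" using h s[OF y] by (auto simp: sigma_sigma)
  qed (simp add: group_orbit_self)
  then show ?thesis using x by blast
qed

lemma card_oriented_orbits_le:
  "card (group_orbits oriented_generators (crosses M)) \<le> 2 * card (group_orbits generators (crosses M))"
proof -
  let ?O = "group_orbit oriented_generators" and ?G = "group_orbits generators (crosses M)"
  \<comment> \<open>The representative \<open>r A\<close> of a full orbit \<open>A\<close> names the
    at most two oriented orbits inside \<open>A\<close>.\<close>
  define r where "r A = (SOME a. a \<in> A)" for A :: "'a set"
  have "group_orbits oriented_generators (crosses M) \<subseteq> (\<Union>A\<in>?G. {?O (r A), ?O (sigma M (r A))})"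
  proof
    fix X assume "X \<in> group_orbits oriented_generators (crosses M)"
    then obtain x where x: "x \<in> crosses M" "X = ?O x" by (auto simp: group_orbits_def)
    let ?A = "group_orbit generators x"
    have r: "r ?A \<in> ?A" unfolding r_def by (rule someI_ex) (rule exI, rule group_orbit_self)
    have rC: "r ?A \<in> crosses M" using generators_orbit_subset[OF x(1)] r by blast
    have "x \<in> group_orbit generators (r ?A)" using group_orbit_sym[OF generators_bij r] .
    then have "?O x = ?O (r ?A) \<or> ?O x = ?O (sigma M (r ?A))"
      using generators_orbit_cases[OF rC] group_orbit_eq[OF oriented_generators_bij] by blast
    moreover have "?A \<in> ?G" using x by (simp add: group_orbits_def)
    ultimately show "X \<in> (\<Union>A\<in>?G. {?O (r A), ?O (sigma M (r A))})" using x by blast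
  qed
  moreover have fin: "finite ?G" using finite_crosses by (simp add: group_orbits_def)
  ultimately have "card (group_orbits oriented_generators (crosses M))
      \<le> card (\<Union>A\<in>?G. {?O (r A), ?O (sigma M (r A))})"
    by (intro card_mono) auto
  also have "\<dots> \<le> (\<Sum>A\<in>?G. card {?O (r A), ?O (sigma M (r A))})"
    by (rule card_UN_le[OF fin])
  also have "\<dots> \<le> of_nat (card ?G) * 2"
    by (rule sum_bounded_above) (simp add: card_insert_if)
  finally show ?thesis by simp
qed

theorem euler_genus_nonneg: "0 \<le> euler_genus M"
proof -
  interpret D: premap "dual_map M" by (rule premap_dual)
  have "2 * card (vertex_at (dual_map M) ` crosses M) = num_cycles (phi M) (crosses M)"
    using D.twice_card_vertices by simp
  moreover have "2 * num_cycles (theta M \<circ> sigma M) (crosses M) = card (crosses M)"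
    using twice_num_cycles_theta_sigma[of "crosses M"] by (simp add: num_cycles_def theta_mem sigma_mem)
  moreover have "num_cycles (tau M) (crosses M) + num_cycles (theta M \<circ> sigma M) (crosses M)
      + num_cycles (phi M) (crosses M)
      \<le> card (crosses M) + 2 * card (group_orbits oriented_generators (crosses M))"
    using num_cycles_genus[OF tau_permutes theta_sigma_permutes finite_crosses]
    by (simp add: phi_def comp_assoc insert_commute)
  ultimately have "card (vertex_at M ` crosses M) + card (vertex_at (dual_map M) ` crosses M)
      \<le> num_edges M + 2 * card (group_orbits generators (crosses M))"
    using card_oriented_orbits_le twice_card_vertices four_num_edges by linarith
  \<comment> \<open>Each isolated vertex adds two to \<open>2 k\<close> and one to each of
    \<open>v\<close> and \<open>f\<close>, so the empty cycles cancel.\<close>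
  then show ?thesis
    unfolding euler_genus_def num_components_alt num_vertices_alt num_faces_alt by simp
qed

text \<open>Each vertex has exactly one of its two cycles in \<open>U\<close>, since
  \<open>\<sigma>\<close> exchanges \<open>U\<close> with the remaining crosses. Applied to the dual
  map, this counts faces.\<close>

lemma card_vertices_half:
  assumes U: "U \<subseteq> crosses M" "\<And>x. x \<in> U \<Longrightarrow> tau M x \<in> U"
    "\<And>x. x \<in> crosses M \<Longrightarrow> sigma M x \<in> U \<longleftrightarrow> x \<notin> U"
  shows "card (orbit (tau M) ` U) = card (vertex_at M ` crosses M)"
proof -
  let ?f = "\<lambda>X. {X, sigma M ` X}"
  have sub: "orbit (tau M) x \<subseteq> U" if "x \<in> U" for x
    using that U(2) by (intro orbit_closed_subset)
  have "inj_on ?f (orbit (tau M) ` U)"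
  proof (rule inj_onI)
    fix X Y assume "X \<in> orbit (tau M) ` U" "Y \<in> orbit (tau M) ` U" and eq: "?f X = ?f Y"
    then obtain x y where "x \<in> U" "X = orbit (tau M) x" "y \<in> U" "Y = orbit (tau M) y" by blast
    then have XY: "X \<subseteq> U" "Y \<subseteq> U" "X \<noteq> {}"
      using sub orbit_nonempty[of "tau M" x] by simp_all
    show "X = Y"
    proof (rule ccontr)
      assume "X \<noteq> Y"
      then have "X = sigma M ` Y" using eq by (auto simp: doubleton_eq_iff)
      then show False using XY U(1,3) by blast
    qed
  qed
  then have "card (orbit (tau M) ` U) = card (?f ` orbit (tau M) ` U)" by (simp add: card_image)
  moreover have "?f ` orbit (tau M) ` U = vertex_at M ` crosses M"
  proof (intro equalityI subsetI)
    fix v assume "v \<in> vertex_at M ` crosses M"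
    then obtain x where x: "x \<in> crosses M" "v = vertex_at M x" by blast
    have "vertex_at M (sigma M x) = vertex_at M x"
      by (simp add: vertex_at_def sigma_sigma insert_commute)
    then obtain y where "y \<in> U" "v = vertex_at M y" using x U(3) by metis
    then show "v \<in> ?f ` orbit (tau M) ` U" by (auto simp: vertex_at_alt)
  qed (use U in \<open>auto simp: vertex_at_alt\<close>)
  ultimately show ?thesis by simp
qed

theorem even_euler_genus:
  assumes conn: "\<And>a. a \<in> crosses M \<Longrightarrow> group_orbit generators a = crosses M"
    and two: "card (group_orbits oriented_generators (crosses M)) = 2"
  shows "even (euler_genus M)"
proof -
  interpret D: premap "dual_map M" by (rule premap_dual)
  have "group_orbits oriented_generators (crosses M) \<noteq> {}" using two by auto
  then obtain a where a: "a \<in> crosses M" by (auto simp: group_orbits_def)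
  have sa: "sigma M a \<in> crosses M" using a by (simp add: sigma_mem)
  let ?o = "group_orbit oriented_generators"
  define U where "U = ?o a"
  have U: "U \<subseteq> crosses M" unfolding U_def by (rule oriented_orbit_subset[OF a])
  have fin: "finite U" using U finite_crosses finite_subset by blast
  have cases: "x \<in> U \<or> x \<in> ?o (sigma M a)" if "x \<in> crosses M" for x
    using generators_orbit_cases[OF a, of x] conn[OF a] that by (simp add: U_def)
  have disj: "U \<inter> ?o (sigma M a) = {}"
  proof (rule ccontr)
    assume "U \<inter> ?o (sigma M a) \<noteq> {}"
    then have "?o (sigma M a) = U"
      unfolding U_def using group_orbit_eq[OF oriented_generators_bij] by blast
    then have "?o x = U" if "x \<in> crosses M" for x
      using cases[OF that] group_orbit_eq[OF oriented_generators_bij] unfolding U_def by blast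
    then have "group_orbits oriented_generators (crosses M) = {U}"
      using a by (auto simp: group_orbits_def)
    then show False using two by simp
  qed
  have sO: "sigma M x \<in> U \<longleftrightarrow> x \<notin> U" if x: "x \<in> crosses M" for x
    using cases[OF x] disj sigma_oriented_orbit[OF a, of x] sigma_oriented_orbit[OF sa, of x]
    by (auto simp: sigma_sigma U_def)
  have tsO: "theta M (sigma M x) \<in> U" and tO: "tau M x \<in> U" if "x \<in> U" for x
    using oriented_orbit_step that by (simp_all add: U_def)
  \<comment> \<open>\<open>\<theta>\<sigma>\<close> preserves \<open>U\<close> and
    \<open>\<sigma>\<close> exchanges it with the rest, so \<open>\<theta>\<close> does as well.
    This makes \<open>U\<close> a half for the dual map too.\<close>
  have thO: "theta M x \<in> U \<longleftrightarrow> x \<notin> U" if x: "x \<in> crosses M" for x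
    using sO[OF x] tsO[of x] tsO[of "sigma M x"] sO[of "theta M x"] x
    by (auto simp: sigma_sigma theta_sigma theta_mem)
  \<comment> \<open>On \<open>U\<close> the product \<open>?p \<circ> ?q\<close> is
    \<open>\<phi>\<close>, so the parity statement can be used on \<open>U\<close> alone.\<close>
  let ?p = "perm_restrict (tau M) U" and ?q = "perm_restrict (theta M \<circ> sigma M) U"
  have p: "?p permutes U" using perm_restrict_permutes[OF tau_permutes fin] tO by blast
  have q: "?q permutes U" using perm_restrict_permutes[OF theta_sigma_permutes fin] tsO by simp
  have "orbit ?p x = orbit (tau M) x" "orbit ?q x = orbit (theta M \<circ> sigma M) x"
    "orbit (?p \<circ> ?q) x = orbit (phi M) x" if x: "x \<in> U" for x
    using tO tsO by (rule_tac orbit_cong0[OF x]; simp add: perm_restrict_simps phi_apply)+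
  then have "num_cycles ?p U = card (orbit (tau M) ` U)"
    "num_cycles ?q U = card (orbit (theta M \<circ> sigma M) ` U)"
    "num_cycles (?p \<circ> ?q) U = card (orbit (phi M) ` U)"
    unfolding num_cycles_def by (simp_all cong: image_cong)
  moreover have "even (card U + num_cycles ?p U + num_cycles ?q U + num_cycles (?p \<circ> ?q) U)"
    using num_cycles_genus[OF p q fin] by blast
  moreover have "card (orbit (tau M) ` U) = card (vertex_at M ` crosses M)"
    using U tO sO by (intro card_vertices_half)
  moreover have "card (orbit (phi M) ` U) = card (vertex_at (dual_map M) ` crosses M)"
    using D.card_vertices_half[of U] U tO tsO thO by (simp add: phi_apply)
  moreover have iota: "2 * card (orbit (theta M \<circ> sigma M) ` U) = card U"
    using U tsO by (intro twice_num_cycles_theta_sigma)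
  moreover have half: "card (crosses M) = 2 * card U"
  proof -
    have "crosses M = U \<union> sigma M ` U"
    proof (intro equalityI subsetI)
      fix x assume x: "x \<in> crosses M"
      then show "x \<in> U \<union> sigma M ` U" using sO[of x] sigma_sigma[of x] by (metis UnCI image_eqI)
    qed (use U sigma_mem in auto)
    moreover have "U \<inter> sigma M ` U = {}" using U sO by blast
    moreover have "card (sigma M ` U) = card U"
      by (rule card_image[OF permutes_inj_on[OF sigma_permutes]])
    ultimately show ?thesis using card_Un_disjoint[OF fin finite_imageI[OF fin]] by simp
  qed
  moreover have "card U = 2 * num_edges M" "card (orbit (theta M \<circ> sigma M) ` U) = num_edges M"
    using four_num_edges iota half by linarith+
  \<comment> \<open>\<open>2 * num_edges M\<close> is the number of crosses in \<open>U\<close>, the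
    single \<open>num_edges M\<close> that of the cycles of \<open>\<theta>\<sigma>\<close>
    there.\<close>
  ultimately have "even (2 * num_edges M + card (vertex_at M ` crosses M) + num_edges M
      + card (vertex_at (dual_map M) ` crosses M))"
    by (simp only:)
  then show ?thesis
    unfolding euler_genus_def num_vertices_alt num_faces_alt by auto
qed

section \<open>Components\<close>

text \<open>\<open>K\<close> will assign to a cross its vertex, face or edge. By the assumption
  distinct components have disjoint images under \<open>K\<close>, so the counts add up.\<close>

lemma card_image_group_orbits:
  assumes "\<And>x y. x \<in> crosses M \<Longrightarrow> y \<in> crosses M \<Longrightarrow> K x = K y \<Longrightarrow>
    group_orbit generators x = group_orbit generators y"
  shows "card (K ` crosses M) = (\<Sum>A\<in>group_orbits generators (crosses M). card (K ` A))"
proof -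
  let ?G = "group_orbits generators (crosses M)"
  have G: "A \<subseteq> crosses M" "\<And>x. x \<in> A \<Longrightarrow> group_orbit generators x = A" if "A \<in> ?G" for A
    using that generators_orbit_subset group_orbit_eq[OF generators_bij]
    by (auto simp: group_orbits_def)
  have "crosses M = \<Union>?G"
    using generators_orbit_subset group_orbit_self by (fastforce simp: group_orbits_def)
  then have "K ` crosses M = (\<Union>A\<in>?G. K ` A)" by blast
  also have "card \<dots> = (\<Sum>A\<in>?G. card (K ` A))"
  proof (rule card_UN_disjoint)
    show "finite ?G" using finite_crosses by (simp add: group_orbits_def)
    show "\<forall>A\<in>?G. finite (K ` A)" using G(1) finite_crosses finite_subset by blast
    show "\<forall>A\<in>?G. \<forall>B\<in>?G. A \<noteq> B \<longrightarrow> K ` A \<inter> K ` B = {}"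
    proof (intro ballI impI)
      fix A B assume AB: "A \<in> ?G" "B \<in> ?G" "A \<noteq> B"
      show "K ` A \<inter> K ` B = {}"
      proof (rule ccontr)
        assume "K ` A \<inter> K ` B \<noteq> {}"
        then obtain x y where "x \<in> A" "y \<in> B" "K x = K y" by blast
        then show False using assms[of x y] G[OF AB(1)] G[OF AB(2)] AB(3) by blast
      qed
    qed
  qed
  finally show ?thesis .
qed

text \<open>\<open>A\<close> is closed under the generators, so restricting to it leaves the edges
  and the cycles of \<open>\<tau>\<close> and \<open>\<phi>\<close> inside \<open>A\<close>
  intact.\<close>

lemma component_facts:
  assumes A: "A \<in> group_orbits generators (crosses M)"
  defines "N \<equiv> restrict_map_to M A"
  shows "premap N"
    and "\<And>a. a \<in> crosses N \<Longrightarrow> group_orbit {theta N, sigma N, tau N} a = crosses N"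
    and "num_components N = 1"
    and "num_vertices N = card (vertex_at M ` A)"
    and "num_faces N = card (vertex_at (dual_map M) ` A)"
    and "num_edges N = card (map_edge M ` A)"
proof -
  obtain r where r: "r \<in> crosses M" "A = group_orbit generators r"
    using A by (auto simp: group_orbits_def)
  have AC: "A \<subseteq> crosses M" using r generators_orbit_subset by simp
  have fin: "finite A" using AC finite_crosses finite_subset by blast
  have closed: "theta M x \<in> A" "sigma M x \<in> A" "tau M x \<in> A" if "x \<in> A" for x
    using generators_orbit_step that r by auto
  have iff: "theta M x \<in> A \<longleftrightarrow> x \<in> A" "sigma M x \<in> A \<longleftrightarrow> x \<in> A" "tau M x \<in> A \<longleftrightarrow> x \<in> A" for x
    using permutes_mem_closed_iff[OF theta_permutes fin] permutes_mem_closed_iff[OF sigma_permutes fin]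
      permutes_mem_closed_iff[OF tau_permutes fin] closed by blast+
  have N: "crosses N = A" "theta N = perm_restrict (theta M) A" "sigma N = perm_restrict (sigma M) A"
    "tau N = perm_restrict (tau M) A" "empty_cycles N = 0"
    by (simp_all add: N_def restrict_map_to_def)
  show prem: "premap N"
  proof
    show "theta N permutes crosses N" "sigma N permutes crosses N" "tau N permutes crosses N"
      using perm_restrict_permutes[OF _ fin] theta_permutes sigma_permutes tau_permutes closed
      by (simp_all add: N)
    fix x
    show "theta N (theta N x) = x" "sigma N (sigma N x) = x" "theta N (sigma N x) = sigma N (theta N x)"
      "tau N (sigma N (tau N x)) = sigma N x"
      by (cases "x \<in> A"; simp add: N perm_restrict_def iff theta_theta sigma_sigma theta_sigma tau_sigma_tau)+
    assume x: "x \<in> crosses N"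
    then show "theta N x \<noteq> x" "sigma N x \<noteq> x" "theta N (sigma N x) \<noteq> x" "tau N x \<noteq> sigma N x"
      using AC theta_neq[of x] sigma_neq[of x] theta_sigma_neq[of x] tau_neq_sigma[of x]
      by (auto simp: N perm_restrict_def iff)
  qed (simp_all add: N fin)
  interpret N: premap N by (rule prem)
  show orbit_N: "group_orbit {theta N, sigma N, tau N} a = crosses N" if "a \<in> crosses N" for a
  proof (rule equalityI)
    let ?X = "group_orbit {theta N, sigma N, tau N} a"
    show sub: "?X \<subseteq> crosses N" using N.generators_orbit_subset[OF that] .
    have aA: "a \<in> A" using that N by simp
    have "group_orbit generators a \<subseteq> ?X"
    proof (rule group_orbit_subset[OF generators_permute])
      show "finite ?X" using sub N.finite_crosses finite_subset by blast
      fix h x assume h: "h \<in> generators" and x: "x \<in> ?X"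
      have "x \<in> A" using x sub N by auto
      then have "theta M x = theta N x" "sigma M x = sigma N x" "tau M x = tau N x"
        by (simp_all add: N perm_restrict_simps)
      then show "h x \<in> ?X" using h N.generators_orbit_step[OF x] by auto
    qed (rule group_orbit_self)
    moreover have "group_orbit generators a = A"
      using aA r group_orbit_eq[OF generators_bij, of a r] by simp
    ultimately show "crosses N \<subseteq> ?X" using N by simp
  qed
  have "A \<noteq> {}" using r(2) group_orbit_self[of r generators] by blast
  then have "group_orbits {theta N, sigma N, tau N} (crosses N) = {A}"
    using orbit_N N(1) by (auto simp: group_orbits_def)
  then show "num_components N = 1" by (simp add: num_components_alt N)
  have phiN: "phi N x = phi M x" if "x \<in> A" for x
    using that closed by (simp add: N.phi_apply phi_apply N perm_restrict_simps)
  have "orbit (tau N) x = orbit (tau M) x" "orbit (phi N) x = orbit (phi M) x" if x: "x \<in> A" for x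
    using closed phiN
    by (rule_tac orbit_cong0[OF x]; simp add: N perm_restrict_simps phi_apply)+
  then have "vertex_at N x = vertex_at M x" "vertex_at (dual_map N) x = vertex_at (dual_map M) x"
    "map_edge N x = map_edge M x" if x: "x \<in> A" for x
    using x closed by (simp_all add: vertex_at_def N perm_restrict_simps map_edge_def)
  then show "num_vertices N = card (vertex_at M ` A)"
    "num_faces N = card (vertex_at (dual_map M) ` A)" "num_edges N = card (map_edge M ` A)"
    unfolding num_vertices_alt num_faces_alt num_edges_def edges_def
    by (simp_all add: N(1,5) cong: image_cong)
qed

lemma vertex_at_eqD:
  assumes "vertex_at M x = vertex_at M y"
  shows "group_orbit generators x = group_orbit generators y"
proof -
  have sub: "orbit (tau M) z \<subseteq> group_orbit generators z" for z
    by (intro orbit_closed_subset group_orbit_self generators_orbit_step)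
  have "orbit (tau M) x \<in> vertex_at M y" using assms by (auto simp: vertex_at_def)
  then have "x \<in> orbit (tau M) y \<or> x \<in> orbit (tau M) (sigma M y)"
    using orbit_tau_self[of x] by (auto simp: vertex_at_def)
  moreover have "group_orbit generators (sigma M y) = group_orbit generators y"
    by (intro group_orbit_eq[OF generators_bij] generators_orbit_step group_orbit_self)
  ultimately have "x \<in> group_orbit generators y" using sub by blast
  then show ?thesis by (rule group_orbit_eq[OF generators_bij])
qed

text \<open>\<open>\<phi>\<close> is a product of generators. Hence crosses of one face, connected
  in the dual, are connected in \<open>M\<close>.\<close>

lemma dual_generators_orbit_subset:
  assumes "x \<in> crosses M"
  shows "group_orbit {sigma M, theta M, phi M} x \<subseteq> group_orbit generators x"
proof (rule group_orbit_subset)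
  show "\<forall>h\<in>{sigma M, theta M, phi M}. h permutes crosses M"
    using theta_permutes sigma_permutes phi_permutes by simp
  show "finite (group_orbit generators x)"
    using generators_orbit_subset[OF assms] finite_crosses finite_subset by blast
  fix h y assume "h \<in> {sigma M, theta M, phi M}" "y \<in> group_orbit generators x"
  then show "h y \<in> group_orbit generators x"
    using generators_orbit_step by (auto simp: phi_apply)
qed (rule group_orbit_self)

lemma euler_genus_components: "euler_genus M = (\<Sum>N\<in>#components M. euler_genus N)"
proof -
  interpret D: premap "dual_map M" by (rule premap_dual)
  let ?G = "group_orbits generators (crosses M)"
  have fin: "finite ?G" using finite_crosses by (simp add: group_orbits_def)
  have V: "card (vertex_at M ` crosses M) = (\<Sum>A\<in>?G. card (vertex_at M ` A))"
    by (intro card_image_group_orbits vertex_at_eqD)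
  have F: "card (vertex_at (dual_map M) ` crosses M) = (\<Sum>A\<in>?G. card (vertex_at (dual_map M) ` A))"
  proof (rule card_image_group_orbits)
    fix x y assume xy: "x \<in> crosses M" "y \<in> crosses M" "vertex_at (dual_map M) x = vertex_at (dual_map M) y"
    then have "x \<in> group_orbit {sigma M, theta M, phi M} y"
      using D.vertex_at_eqD[OF xy(3)] group_orbit_self by (metis dual_map_simps(2-4))
    then have "x \<in> group_orbit generators y" using dual_generators_orbit_subset xy by blast
    then show "group_orbit generators x = group_orbit generators y"
      by (rule group_orbit_eq[OF generators_bij])
  qed
  have E: "card (map_edge M ` crosses M) = (\<Sum>A\<in>?G. card (map_edge M ` A))"
  proof (rule card_image_group_orbits)
    fix x y assume "map_edge M x = map_edge M y"
    then have "x \<in> map_edge M y" by (auto simp: map_edge_def)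
    then have "x \<in> group_orbit generators y"
      using group_orbit_self[of y generators] generators_orbit_step[of _ y] by (auto simp: map_edge_def)
    then show "group_orbit generators x = group_orbit generators y"
      by (rule group_orbit_eq[OF generators_bij])
  qed
  \<comment> \<open>The value is \<open>2 - 1 + 0 - 1\<close>, so isolated vertices contribute
    nothing to the sum.\<close>
  have iso: "euler_genus isolated_vertex = 0"
    by (simp add: euler_genus_def num_components_alt num_vertices_def num_edges_def num_faces_def
        edges_def isolated_vertex_def group_orbits_def)
  have "(\<Sum>N\<in>#components M. euler_genus N) = (\<Sum>A\<in>?G. euler_genus (restrict_map_to M A))"
    using fin by (simp add: components_def iso image_mset.compositionality comp_def sum_unfold_sum_mset)
  also have "\<dots> = (\<Sum>A\<in>?G. 2 - int (card (vertex_at M ` A)) + int (card (map_edge M ` A))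
      - int (card (vertex_at (dual_map M) ` A)))"
    by (rule sum.cong) (simp_all add: euler_genus_def component_facts)
  also have "\<dots> = euler_genus M"
    unfolding euler_genus_def num_components_alt num_vertices_alt num_faces_alt num_edges_def edges_def V F E
    using even_empty_cycles by (simp add: sum.distrib sum_subtractf algebra_simps)
  finally show ?thesis by simp
qed

lemma component_genus:
  assumes "N \<in># components M"
  shows "0 \<le> euler_genus N" "orientable N \<Longrightarrow> even (euler_genus N)"
proof -
  consider "N = isolated_vertex"
    | A where "A \<in> group_orbits generators (crosses M)" "N = restrict_map_to M A"
    using assms finite_crosses by (auto simp: components_def group_orbits_def split: if_splits)
  then have "0 \<le> euler_genus N \<and> (orientable N \<longrightarrow> even (euler_genus N))"
  proof cases
    case 1
    then show ?thesis
      by (simp add: euler_genus_def num_components_alt num_vertices_def num_edges_def num_faces_def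
          edges_def isolated_vertex_def group_orbits_def)
  next
    case 2
    interpret N: premap N using component_facts(1)[OF 2(1)] 2(2) by simp
    obtain r where "A = group_orbit generators r" using 2(1) by (auto simp: group_orbits_def)
    \<comment> \<open>Having crosses excludes the first alternative of \<open>orientable\<close>,
      which then provides the two oriented orbits.\<close>
    then have "crosses N \<noteq> {}"
      using 2(2) group_orbit_self[of r generators] by (auto simp: restrict_map_to_def)
    then have "N \<noteq> isolated_vertex" by (auto simp: isolated_vertex_def)
    then have "orientable N \<longrightarrow> even (euler_genus N)"
      using N.even_euler_genus component_facts(2)[OF 2(1)] 2(2) by (auto simp: orientable_def)
    then show ?thesis using N.euler_genus_nonneg by simp
  qed
  then show "0 \<le> euler_genus N" "orientable N \<Longrightarrow> even (euler_genus N)" by blast+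
qed

text \<open>Every old orbit with a cross outside \<open>e\<close> contains a new one. Only a
  component consisting of \<open>e\<close> alone can vanish, and its cycles of
  \<open>\<tau>\<close>, at least two, become empty cycles and so at least one isolated
  vertex.\<close>

lemma num_components_delete_edge:
  assumes e: "e \<in> edges M"
  shows "num_components M \<le> num_components (delete_edge M e)"
proof -
  define N where "N = delete_edge M e"
  note closed = edge_closed[OF e]
  interpret N: premap N unfolding N_def using closed by (intro premap_delete)
  let ?O = "group_orbit generators" and ?O' = "group_orbit N.generators"
  have CN: "crosses N = crosses M - e" by (simp add: N_def)
  have sub: "?O' x \<subseteq> ?O x" if x: "x \<in> crosses N" for x
  proof -
    have "?O' x \<subseteq> ?O x \<inter> crosses N"
    proof (rule group_orbit_subset[OF N.generators_permute])
      fix h y assume h: "h \<in> N.generators" and y: "y \<in> ?O x \<inter> crosses N"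
      have "orbit (tau M) y \<subseteq> ?O x"
        using y by (intro orbit_closed_subset generators_orbit_step) auto
      then have "first_return (tau M) e y \<in> ?O x"
        using first_return_mem(2)[of y e] y CN by blast
      then have "tau N y \<in> ?O x" "theta N y \<in> ?O x" "sigma N y \<in> ?O x"
        using y generators_orbit_step[of y x] by (simp_all add: N_def perm_restrict_simps)
      then show "h y \<in> ?O x \<inter> crosses N"
        using h y N.theta_mem N.sigma_mem N.tau_mem by auto
    qed (use N.finite_crosses x group_orbit_self in auto)
    then show ?thesis by blast
  qed
  let ?G = "group_orbits generators (crosses M)" and ?G' = "group_orbits N.generators (crosses N)"
  let ?L = "{orbit (tau M) a |a. a \<in> crosses M \<and> orbit (tau M) a \<subseteq> e}"
  have finG: "finite ?G" "finite ?G'"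
    using finite_crosses N.finite_crosses by (simp_all add: group_orbits_def)
  obtain a where a: "a \<in> crosses M" "e = map_edge M a" using e by (auto simp: edges_def)
  have eO: "e \<subseteq> ?O a"
    unfolding a(2) map_edge_def using group_orbit_self[of a generators] generators_orbit_step[of _ a] by auto
  \<comment> \<open>\<open>s\<close> sends a new orbit to the old orbit around it, which any of its
    elements determines.\<close>
  define s where "s X = ?O (SOME x. x \<in> X)" for X
  have sO: "s (?O' x) = ?O x" if x: "x \<in> crosses N" for x
  proof -
    have "(SOME y. y \<in> ?O' x) \<in> ?O' x" by (rule someI_ex) (rule exI, rule group_orbit_self)
    then show ?thesis unfolding s_def using sub[OF x] group_orbit_eq[OF generators_bij] by blast
  qed
  have cover: "A \<in> s ` ?G'" if A: "A \<in> ?G" "\<not> A \<subseteq> e" for A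
  proof -
    obtain x where x: "x \<in> A" "x \<notin> e" using A by blast
    obtain y where y: "y \<in> crosses M" "A = ?O y" using A by (auto simp: group_orbits_def)
    have xN: "x \<in> crosses N" using x y generators_orbit_subset CN by auto
    have "A = ?O x" using x y group_orbit_eq[OF generators_bij, of x y] by simp
    then have "A = s (?O' x)" using sO[OF xN] by simp
    then show ?thesis using xN by (auto simp: group_orbits_def)
  qed
  have "card ?G + empty_cycles M div 2 \<le> card ?G' + (empty_cycles M + card ?L) div 2"
  proof (cases "?O a \<subseteq> e")
    case False
    have "\<not> A \<subseteq> e" if AG: "A \<in> ?G" for A
    proof
      assume "A \<subseteq> e"
      obtain y where y: "y \<in> crosses M" "A = ?O y" using AG by (auto simp: group_orbits_def)
      have "y \<in> A" unfolding y(2) by (rule group_orbit_self)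
      then have "y \<in> ?O a" using \<open>A \<subseteq> e\<close> eO by blast
      then have "A = ?O a" using y group_orbit_eq[OF generators_bij] by simp
      then show False using \<open>A \<subseteq> e\<close> False by simp
    qed
    then have "?G \<subseteq> s ` ?G'" using cover by blast
    then have "card ?G \<le> card ?G'" using finG by (meson card_image_le card_mono finite_imageI le_trans)
    then show ?thesis by (intro add_mono div_le_mono) auto
  next
    case True
    then have Oa: "?O a = e" using eO by blast
    have "?G - {e} \<subseteq> s ` ?G'"
    proof
      fix A assume A: "A \<in> ?G - {e}"
      obtain y where y: "y \<in> crosses M" "A = ?O y" using A by (auto simp: group_orbits_def)
      have "\<not> A \<subseteq> e"
      proof
        assume "A \<subseteq> e"
        moreover have "y \<in> A" unfolding y(2) by (rule group_orbit_self)
        ultimately have "y \<in> ?O a" using eO by blast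
        then show False using A y(2) group_orbit_eq[OF generators_bij, of y a] Oa by simp
      qed
      then show "A \<in> s ` ?G'" using cover A by blast
    qed
    then have "card (?G - {e}) \<le> card ?G'"
      using finG by (meson card_image_le card_mono finite_imageI le_trans)
    moreover have "e \<in> ?G" using a(1) Oa by (auto simp: group_orbits_def)
    ultimately have "card ?G \<le> Suc (card ?G')"
      using card_Suc_Diff1[OF finG(1), of e] by simp
    moreover have "card ?L \<ge> 2"
    proof -
      have orb: "orbit (tau M) y \<subseteq> e" if "y \<in> e" for y
        using that unfolding Oa[symmetric] by (intro orbit_closed_subset generators_orbit_step)
      have "a \<in> e" using a by (simp add: map_edge_def)
      then have "sigma M a \<in> e" using closed(3) by blast
      then have "{orbit (tau M) a, orbit (tau M) (sigma M a)} \<subseteq> ?L"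
        using \<open>a \<in> e\<close> orb closed(1) by blast
      then have "card {orbit (tau M) a, orbit (tau M) (sigma M a)} \<le> card ?L"
        using finite_crosses by (intro card_mono) simp_all
      moreover have "orbit (tau M) a \<noteq> orbit (tau M) (sigma M a)"
        using sigma_notin_orbit[OF a(1)] orbit_tau_self by metis
      ultimately show ?thesis by simp
    qed
    then have "empty_cycles M div 2 + 1 \<le> (empty_cycles M + card ?L) div 2" by simp
    ultimately show ?thesis by linarith
  qed
  then show ?thesis unfolding num_components_alt N_def[symmetric] by (simp add: N_def)
qed

end

section \<open>Deletion of a set of edges\<close>

lemma premap_foldl_delete:
  assumes "premap M" "distinct es" "set es \<subseteq> edges M"
  shows "premap (foldl delete_edge M es)"
    and "num_components M \<le> num_components (foldl delete_edge M es)"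
proof -
  have "premap (foldl delete_edge M es) \<and> num_components M \<le> num_components (foldl delete_edge M es)"
    using assms
  proof (induction es arbitrary: M)
    case (Cons e es)
    interpret premap M by fact
    have e: "e \<in> edges M" using Cons.prems by simp
    have "edges M - {e} \<subseteq> edges (delete_edge M e)"
      by (rule edges_diff_subset[OF e]) simp_all
    moreover have "premap (delete_edge M e)" using edge_closed[OF e] by (intro premap_delete)
    ultimately show ?case
      using Cons.IH[of "delete_edge M e"] num_components_delete_edge[OF e] Cons.prems by force
  qed simp
  then show "premap (foldl delete_edge M es)"
    "num_components M \<le> num_components (foldl delete_edge M es)" by blast+
qed

lemma premap_delete_edges:
  assumes "premap M" "B \<subseteq> edges M"
  shows "premap (delete_edges M B)" "num_components M \<le> num_components (delete_edges M B)"
proof -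
  have "finite B"
    using assms premap.finite_crosses[OF assms(1)] by (auto simp: edges_def intro: finite_subset)
  then have "\<exists>es. distinct es \<and> set es = B" using finite_distinct_list by blast
  from someI_ex[OF this] show "premap (delete_edges M B)"
    "num_components M \<le> num_components (delete_edges M B)"
    unfolding delete_edges_def using assms by (auto intro!: premap_foldl_delete)
qed

section \<open>Substitution\<close>

definition eval_monomial :: "('v \<Rightarrow> 'r::comm_ring_1) \<Rightarrow> ('v \<Rightarrow>\<^sub>0 nat) \<Rightarrow> 'r" where
  "eval_monomial z m = (\<Prod>v\<in>Poly_Mapping.keys m. z v ^ Poly_Mapping.lookup m v)"

lemma eval_monomial_superset:
  assumes "finite K" "Poly_Mapping.keys m \<subseteq> K"
  shows "eval_monomial z m = (\<Prod>v\<in>K. z v ^ Poly_Mapping.lookup m v)"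
  unfolding eval_monomial_def using assms
  by (intro prod.mono_neutral_left) (auto simp: not_in_keys_iff_lookup_eq_zero)

lemma eval_monomial_0: "eval_monomial z 0 = 1"
  by (simp add: eval_monomial_def)

lemma eval_monomial_add: "eval_monomial z (m + n) = eval_monomial z m * eval_monomial z n"
proof -
  let ?K = "Poly_Mapping.keys m \<union> Poly_Mapping.keys n"
  have "Poly_Mapping.keys (m + n) \<subseteq> ?K" by (rule Poly_Mapping.keys_add)
  then show ?thesis
    by (simp add: eval_monomial_superset[of ?K] lookup_add power_add prod.distrib)
qed

text \<open>Enlarging the index set gives \<open>p\<close>, \<open>q\<close> and
  \<open>p + q\<close> a common one, over which the sums compare termwise.\<close>

lemma substitute_superset:
  assumes "finite K" "Poly_Mapping.keys p \<subseteq> K"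
  shows "substitute z p = (\<Sum>m\<in>K. of_int (Poly_Mapping.lookup p m) * eval_monomial z m)"
  unfolding substitute_def eval_monomial_def[symmetric] using assms
  by (intro sum.mono_neutral_left) (auto simp: not_in_keys_iff_lookup_eq_zero)

lemma substitute_single: "substitute z (Poly_Mapping.single m c) = of_int c * eval_monomial z m"
  by (subst substitute_superset[of "{m}"]) (auto split: if_splits)

lemma substitute_0 [simp]: "substitute z 0 = 0"
  by (simp add: substitute_def)

lemma substitute_add [simp]: "substitute z (p + q) = substitute z p + substitute z q"
proof -
  let ?K = "Poly_Mapping.keys p \<union> Poly_Mapping.keys q"
  have "Poly_Mapping.keys (p + q) \<subseteq> ?K" by (rule Poly_Mapping.keys_add)
  then show ?thesis
    by (simp add: substitute_superset[of ?K] lookup_add sum.distrib distrib_right)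
qed

lemma substitute_sum: "substitute z (sum f A) = (\<Sum>x\<in>A. substitute z (f x))"
  by (induction A rule: infinite_finite_induct) auto

text \<open>Building a polynomial by adding monomials reduces multiplicativity to the case of
  monomials, by distributivity.\<close>

lemma poly_mapping_single_induct [case_names zero add]:
  fixes p :: "'b \<Rightarrow>\<^sub>0 'c::comm_monoid_add"
  assumes "P 0" "\<And>m c q. P q \<Longrightarrow> P (Poly_Mapping.single m c + q)"
  shows "P p"
proof (induction p rule: Poly_Mapping.update_induct)
  case const
  then show ?case using assms(1) .
next
  case (update q m c)
  have "Poly_Mapping.update m c q = Poly_Mapping.single m c + q"
  proof (rule poly_mapping_eqI)
    fix k
    show "Poly_Mapping.lookup (Poly_Mapping.update m c q) k = Poly_Mapping.lookup (Poly_Mapping.single m c + q) k"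
      using update by (auto simp: lookup_update lookup_add lookup_single when_def not_in_keys_iff_lookup_eq_zero)
  qed
  then show ?case using assms(2) update by simp
qed

lemma substitute_single_mult:
  "substitute z (Poly_Mapping.single m c * q) = substitute z (Poly_Mapping.single m c) * substitute z q"
proof (induction q rule: poly_mapping_single_induct)
  case (add n d q)
  then show ?case
    by (simp add: distrib_left mult_single substitute_single eval_monomial_add mult_ac)
qed simp

lemma substitute_mult [simp]: "substitute z (p * q) = substitute z p * substitute z q"
  by (induction p rule: poly_mapping_single_induct)
    (simp_all add: distrib_right substitute_single_mult)

lemma substitute_1 [simp]: "substitute z 1 = 1"
  using substitute_single[of z 0 1] by (simp add: eval_monomial_0)

lemma substitute_power [simp]: "substitute z (p ^ n) = substitute z p ^ n"
  by (induction n) auto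

lemma substitute_prod_mset: "substitute z (\<Prod>x\<in>#A. f x) = (\<Prod>x\<in>#A. substitute z (f x))"
  by (induction A) auto

lemma substitute_var [simp]: "substitute z (var v) = z v"
  by (simp add: var_def substitute_single eval_monomial_def)

text \<open>The constant coefficients are 0 and 1. In the field of fractions this makes
  \<open>X - 1\<close> invertible.\<close>

lemma var_neq_1: "var v \<noteq> 1"
proof
  assume "var v = (1 :: 'a mpoly)"
  then have "Poly_Mapping.lookup (var v :: 'a mpoly) 0 = 1" by simp
  moreover have "Poly_Mapping.single v (1 :: nat) \<noteq> 0" by (metis lookup_single_eq lookup_zero one_neq_zero)
  ultimately show False by (simp add: var_def lookup_single when_def)
qed

lemma to_fract_power: "to_fract (p ^ n) = to_fract p ^ n"
  by (induction n) auto

section \<open>Specialization of the surface Tutte polynomial\<close>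

text \<open>Nonnegativity is carried through the induction because \<open>nat\<close> is additive on
  nonnegative integers only.\<close>

lemma prod_mset_const_power:
  fixes c r :: "'r::comm_ring_1" and s :: "'b \<Rightarrow> int"
  assumes "\<And>N. N \<in># X \<Longrightarrow> 0 \<le> s N" "\<And>N. N \<in># X \<Longrightarrow> f N = c * r ^ nat (s N)"
  shows "0 \<le> (\<Sum>N\<in>#X. s N) \<and> (\<Prod>N\<in>#X. f N) = c ^ size X * r ^ nat (\<Sum>N\<in>#X. s N)"
  using assms
  by (induction X) (simp_all add: nat_add_distrib power_add mult_ac)

text \<open>An orientable component of genus \<open>g\<close> has Euler genus \<open>2 g\<close> and
  receives \<open>(r ^ 2) ^ g\<close>; a non-orientable one of Euler genus \<open>g\<close> receives
  \<open>r ^ g\<close>. Both are \<open>r\<close> to the Euler genus. The uses are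
  \<open>c = 1\<close>, \<open>r = sqrtA\<close> and \<open>c = X - 1\<close>,
  \<open>r = sqrtB\<close>.\<close>

lemma (in premap) prod_components_signed_genus:
  fixes w :: "int \<Rightarrow> 'r::comm_ring_1"
  assumes "\<And>g::nat. w (int g) = c * (r ^ 2) ^ g" "\<And>g::nat. g \<ge> 1 \<Longrightarrow> w (- int g) = c * r ^ g"
  shows "(\<Prod>N\<in>#components M. w (signed_genus N)) = c ^ num_components M * r ^ nat (euler_genus M)"
proof -
  have "w (signed_genus N) = c * r ^ nat (euler_genus N)" if N: "N \<in># components M" for N
  proof -
    obtain s where s: "euler_genus N = int s"
      using component_genus(1)[OF N] nonneg_int_cases by blast
    show ?thesis
    proof (cases "orientable N")
      case True
      then obtain g where "s = 2 * g" using component_genus(2)[OF N] s by auto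
      then show ?thesis using True s assms(1)[of g] by (simp add: signed_genus_def genus_def power_mult nat_mult_distrib)
    next
      case False
      \<comment> \<open>For \<open>s = 0\<close> the negated genus is 0 again, where the first
        assumption gives the value \<open>c\<close>.\<close>
      then show ?thesis
        using s assms(1)[of 0] assms(2)[of s] by (cases "s = 0") (simp_all add: signed_genus_def genus_def)
    qed
  qed
  then show ?thesis
    using prod_mset_const_power[of "components M" euler_genus "\<lambda>N. w (signed_genus N)" c r]
      component_genus(1) by (simp add: num_components_def euler_genus_components)
qed

theorem proposition3p4:
  fixes M :: "'a cmap"
    and X Y sqrtA sqrtB A B :: "krushkal_var mpoly fract"
    and z :: "tutte_var \<Rightarrow> krushkal_var mpoly fract"
  assumes "is_map M"
    and "X = to_fract (var Kx)"
    and "Y = to_fract (var Ky)"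
    and "sqrtA = to_fract (var Ksqrt_a)"
    and "sqrtB = to_fract (var Ksqrt_b)"
    and "A = sqrtA ^ 2"
    and "B = sqrtB ^ 2"
    and "z Tx = 1"
    and "z Ty = Y"
    and "\<And>g::nat. z (Txi (int g)) = A ^ g"
    and "\<And>g::nat. z (Tyi (int g)) = (X - 1) * B ^ g"
    and "\<And>g::nat. g \<ge> 1 \<Longrightarrow> z (Txi (- int g)) = sqrtA ^ g"
    and "\<And>g::nat. g \<ge> 1 \<Longrightarrow> z (Tyi (- int g)) = (X - 1) * sqrtB ^ g"
  shows "to_fract (krushkal M) =
    (X - 1) powi (- int (num_components M)) * substitute z (surface_tutte M)"
proof -
  have M: "premap M" using is_map_premap assms(1) .
  have X1: "to_fract (var Kx - 1) = X - 1" using assms(2) by simp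
  have "X - 1 \<noteq> 0"
    using var_neq_1 unfolding X1[symmetric] to_fract_eq_0_iff by (simp only: right_minus_eq not_False_eq_True)
  \<comment> \<open>\<open>C\<close> stands for the contraction and \<open>D\<close> for the
    deletion. The exponent \<open>n\<close> of \<open>Y\<close> is common to both sides, and the
    power of \<open>z Tx\<close> is 1 for every \<open>m\<close>.\<close>
  have summand: "(X - 1) ^ (num_components D - num_components M) * Y ^ n * sqrtA ^ nat (euler_genus C)
        * sqrtB ^ nat (euler_genus D)
      = (X - 1) powi (- int (num_components M)) *
        (z Tx ^ m * z Ty ^ n * (\<Prod>N\<in>#components C. z (Txi (signed_genus N)))
         * (\<Prod>N\<in>#components D. z (Tyi (signed_genus N))))"
    if "premap C" "premap D" "num_components M \<le> num_components D" for C D :: "'a cmap" and m n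
  proof -
    have "(\<Prod>N\<in>#components C. z (Txi (signed_genus N))) = 1 ^ num_components C * sqrtA ^ nat (euler_genus C)"
      using assms(10,12) by (intro premap.prod_components_signed_genus[OF that(1)]) (simp_all add: assms(6))
    moreover have "(\<Prod>N\<in>#components D. z (Tyi (signed_genus N)))
        = (X - 1) ^ num_components D * sqrtB ^ nat (euler_genus D)"
      using assms(11,13) by (intro premap.prod_components_signed_genus[OF that(2)]) (simp_all add: assms(7))
    \<comment> \<open>The bound on the numbers of components makes the subtraction exact.\<close>
    moreover have "(X - 1) ^ (num_components D - num_components M)
        = (X - 1) powi (- int (num_components M)) * (X - 1) ^ num_components D"
      using power_diff[OF \<open>X - 1 \<noteq> 0\<close> that(3)]
      by (simp add: power_int_minus divide_inverse mult.commute)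
    ultimately show ?thesis using assms(8,9) by (simp add: mult_ac)
  qed
  show ?thesis
    unfolding krushkal_def surface_tutte_def to_fract_sum substitute_sum sum_distrib_left
  proof (rule sum.cong[OF refl])
    fix S assume "S \<in> Pow (edges M)"
    then have "premap (contract_edges M S)" "premap (delete_edges M (edges M - S))"
      "num_components M \<le> num_components (delete_edges M (edges M - S))"
      using premap_contract_edges[OF M] premap_delete_edges[OF M, of "edges M - S"] by auto
    from summand[OF this]
    show "to_fract ((var Kx - 1) ^ (num_components (delete_edges M (edges M - S)) - num_components M) *
        var Ky ^ nat (nullity (delete_edges M (edges M - S))) *
        var Ksqrt_a ^ nat (euler_genus (contract_edges M S)) *
        var Ksqrt_b ^ nat (euler_genus (delete_edges M (edges M - S))))
      = (X - 1) powi (- int (num_components M)) * substitute z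
       (var Tx ^ nat (dual_nullity (contract_edges M S)) *
        var Ty ^ nat (nullity (delete_edges M (edges M - S))) *
        (\<Prod>N\<in>#components (contract_edges M S). var (Txi (signed_genus N))) *
        (\<Prod>N\<in>#components (delete_edges M (edges M - S)). var (Tyi (signed_genus N))))"
      by (simp only: to_fract_mult to_fract_power X1 substitute_mult substitute_power substitute_var
          substitute_prod_mset flip: assms(3-5))
  qed
qed

end
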